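(* (1) A finite group $G$ is nilpotent if and only if every maximal subgroup of $G$ is $\tilde{\mathrm{F}}(G)$-subnormal. (2) Let $\mathfrak{F}$ be a class of finite groups closed under homomorphic images which contains every finite group $G$ all of whose maximal subgroups are $\mathrm{F}^*(G)$-subnormal. Then $\mathfrak{F}$ is the class of all finite groups.
   Context: For a subgroup $R$ of $G$, a subgroup $H$ of $G$ is $R$-subnormal if $H$ is subnormal in $\langle H,R\rangle$. $\tilde{\mathrm{F}}(G)$ is defined by $\Phi(G)\subseteq\tilde{\mathrm{F}}(G)$ and $\tilde{\mathrm{F}}(G)/\Phi(G)=\mathrm{Soc}(G/\Phi(G))$; $\mathrm{F}^*(G)$ is the generalized Fitting subgroup. *)

theory Defs
  imports "HOL-Algebra.Algebra"
begin

inductive subnormal_in :: "('a, 'b) monoid_scheme \<Rightarrow> 'a set \<Rightarrow> 'a set \<Rightarrow> bool"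
  for G where
  refl: "subgroup H G \<Longrightarrow> subnormal_in G H H"
| step: "subnormal_in G H K \<Longrightarrow> subgroup L G \<Longrightarrow> K \<lhd> (G\<lparr>carrier := L\<rparr>) \<Longrightarrow> subnormal_in G H L"

definition R_subnormal :: "('a, 'b) monoid_scheme \<Rightarrow> 'a set \<Rightarrow> 'a set \<Rightarrow> bool" where
  "R_subnormal G R H \<longleftrightarrow> subgroup H G \<and> subnormal_in G H (generate G (H \<union> R))"

definition maximal_subgroup :: "('a, 'b) monoid_scheme \<Rightarrow> 'a set \<Rightarrow> bool" where
  "maximal_subgroup G M \<longleftrightarrow> subgroup M G \<and> M \<noteq> carrier G \<and>
     (\<forall>K. subgroup K G \<longrightarrow> M \<subseteq> K \<longrightarrow> K = M \<or> K = carrier G)"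

(* Frattini subgroup: intersection of all maximal subgroups (G if there are none) *)
definition frattini :: "('a, 'b) monoid_scheme \<Rightarrow> 'a set" where
  "frattini G = carrier G \<inter> \<Inter> {M. maximal_subgroup G M}"

definition minimal_normal :: "('a, 'b) monoid_scheme \<Rightarrow> 'a set \<Rightarrow> bool" where
  "minimal_normal G N \<longleftrightarrow> N \<lhd> G \<and> N \<noteq> {\<one>\<^bsub>G\<^esub>} \<and>
     (\<forall>K. K \<lhd> G \<longrightarrow> K \<subseteq> N \<longrightarrow> K = {\<one>\<^bsub>G\<^esub>} \<or> K = N)"

definition socle :: "('a, 'b) monoid_scheme \<Rightarrow> 'a set" where
  "socle G = generate G (\<Union> {N. minimal_normal G N})"

(* F~(G): the preimage of Soc(G/Phi(G)) in G *)
definition F_tilde :: "('a, 'b) monoid_scheme \<Rightarrow> 'a set" where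
  "F_tilde G = \<Union> (socle (G Mod frattini G))"

definition commutator :: "('a, 'b) monoid_scheme \<Rightarrow> 'a set \<Rightarrow> 'a set \<Rightarrow> 'a set" where
  "commutator G H K = generate G {h \<otimes>\<^bsub>G\<^esub> k \<otimes>\<^bsub>G\<^esub> inv\<^bsub>G\<^esub> h \<otimes>\<^bsub>G\<^esub> inv\<^bsub>G\<^esub> k | h k. h \<in> H \<and> k \<in> K}"

fun lower_central :: "('a, 'b) monoid_scheme \<Rightarrow> nat \<Rightarrow> 'a set" where
  "lower_central G 0 = carrier G"
| "lower_central G (Suc n) = commutator G (lower_central G n) (carrier G)"

definition nilpotent_group :: "('a, 'b) monoid_scheme \<Rightarrow> bool" where
  "nilpotent_group G \<longleftrightarrow> group G \<and> (\<exists>n. lower_central G n = {\<one>\<^bsub>G\<^esub>})"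

definition center :: "('a, 'b) monoid_scheme \<Rightarrow> 'a set" where
  "center G = {z \<in> carrier G. \<forall>g \<in> carrier G. z \<otimes>\<^bsub>G\<^esub> g = g \<otimes>\<^bsub>G\<^esub> z}"

definition quasisimple :: "('a, 'b) monoid_scheme \<Rightarrow> bool" where
  "quasisimple G \<longleftrightarrow> group G \<and> derived G (carrier G) = carrier G \<and> simple_group (G Mod center G)"

definition component :: "('a, 'b) monoid_scheme \<Rightarrow> 'a set \<Rightarrow> bool" where
  "component G K \<longleftrightarrow> subnormal_in G K (carrier G) \<and> quasisimple (G\<lparr>carrier := K\<rparr>)"

definition layer :: "('a, 'b) monoid_scheme \<Rightarrow> 'a set" where
  "layer G = generate G (\<Union> {K. component G K})"

definition fitting :: "('a, 'b) monoid_scheme \<Rightarrow> 'a set" where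
  "fitting G = generate G (\<Union> {N. N \<lhd> G \<and> nilpotent_group (G\<lparr>carrier := N\<rparr>)})"

definition F_star :: "('a, 'b) monoid_scheme \<Rightarrow> 'a set" where
  "F_star G = generate G (fitting G \<union> layer G)"

end

theory Submission
  imports Defs "HOL-Combinatorics.Permutations" "HOL-Library.Numeral_Type"
begin

text \<open>For the first part, let every maximal subgroup be \<open>F~(G)\<close>-subnormal. If \<open>G'\<close> were not contained in
  \<open>\<Phi>(G)\<close>, there would be a minimal normal subgroup \<open>N/\<Phi>(G)\<close> of \<open>G/\<Phi>(G)\<close> inside its derived subgroup
  and a maximal subgroup \<open>M\<close> not containing \<open>N\<close>. Then \<open>M\<close> does not contain \<open>F~(G)\<close>, so \<open>M\<close> is subnormal,
  hence normal, in \<open>G\<close>; thus \<open>G/M\<close> is abelian and \<open>N \<le> G' \<Phi>(G) \<le> M\<close>, a contradiction. Hence all maximal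
  subgroups are normal and \<open>G\<close> is nilpotent by the Frattini argument.

  For the second part it suffices to exhibit every finite group \<open>G\<close> as a quotient of a finite group \<open>H\<close>
  with \<open>F*(H) \<le> \<Phi>(H)\<close>. The wreath product \<open>W\<close> of \<open>S\<^sub>5\<close> by \<open>G\<close> maps onto \<open>G\<close>, and each of its nontrivial normal
  subgroups contains a fixed element \<open>g\<close> of order 3 together with an element \<open>t\<close> inverting it. Inducing
  the extension \<open>\<int>/9 \<rightarrow> \<langle>g\<rangle>\<close> gives an extension \<open>E\<close> of \<open>W\<close> by an elementary abelian 3-group in which no lift
  of \<open>g\<close> has order 3. Let \<open>H \<le> E\<close> be minimal with image \<open>W\<close>, so that the kernel \<open>K\<close> of \<open>H \<rightarrow> W\<close> lies in
  \<open>\<Phi>(H)\<close>. If the centralizer of \<open>K\<close> had nontrivial image in \<open>W\<close>, it would contain lifts of \<open>g\<close> and \<open>t\<close>; after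
  multiplying the lift \<open>x\<close> of \<open>g\<close> by an element of \<open>K\<close> it is inverted by the lift of \<open>t\<close>, so \<open>x\<^sup>3 \<in> K\<close> is both
  inverted and centralized, and \<open>x\<^sup>3 = 1\<close>, a contradiction. So \<open>K\<close> is self-centralizing. Since components
  centralize \<open>K\<close>, there are none; and a nilpotent normal subgroup of \<open>W\<close> cannot contain \<open>g\<close> and \<open>t\<close>.
  Hence \<open>F*(H) \<le> K \<le> \<Phi>(H)\<close>.\<close>

section \<open>Frattini subgroup and subnormal maximal subgroups\<close>

lemma (in group) inv_cancel_left:
  assumes "x \<in> carrier G" "y \<in> carrier G"
  shows "inv x \<otimes> (x \<otimes> y) = y" "x \<otimes> (inv x \<otimes> y) = y"
  using assms by (simp_all add: m_assoc[symmetric])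

lemma (in group) maximal_subgroup_exists:
  assumes "finite (carrier G)" "subgroup H G" "H \<noteq> carrier G"
  obtains M where "maximal_subgroup G M" "H \<subseteq> M"
proof -
  let ?S = "{K. subgroup K G \<and> K \<noteq> carrier G}"
  have "?S \<subseteq> Pow (carrier G)" using subgroup.subset by blast
  then have "finite ?S" using assms(1) by (meson finite_Pow_iff finite_subset)
  then obtain M where M: "M \<in> ?S" "H \<subseteq> M" "\<forall>K\<in>?S. M \<subseteq> K \<longrightarrow> M = K"
    using finite_has_maximal2[of ?S H] assms by auto
  then have "maximal_subgroup G M" unfolding maximal_subgroup_def by auto
  with M(2) show ?thesis by (rule that[rotated])
qed

lemma (in group) minimal_normal_exists:
  assumes "finite (carrier G)" "K \<lhd> G" "K \<noteq> {\<one>}"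
  obtains N where "minimal_normal G N" "N \<subseteq> K"
proof -
  let ?S = "{N. N \<lhd> G \<and> N \<noteq> {\<one>}}"
  have "?S \<subseteq> Pow (carrier G)" using subgroup.subset normal_imp_subgroup by blast
  then have "finite ?S" using assms(1) by (meson finite_Pow_iff finite_subset)
  then obtain N where N: "N \<in> ?S" "N \<subseteq> K" "\<forall>L\<in>?S. L \<subseteq> N \<longrightarrow> N = L"
    using finite_has_minimal2[of ?S K] assms by auto
  then have "minimal_normal G N" unfolding minimal_normal_def by auto
  with N(2) show ?thesis by (rule that[rotated])
qed

lemma subnormal_in_subgroup:
  "subnormal_in G H L \<Longrightarrow> subgroup H G \<and> subgroup L G \<and> H \<subseteq> L"
proof (induction rule: subnormal_in.induct)
  case (step H K L)
  have "K \<subseteq> L" using subgroup.subset[OF normal_imp_subgroup[OF step(3)]] by simp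
  with step show ?case by auto
qed auto

text \<open>By maximality every term of a subnormal chain from \<open>M\<close> to the whole group
  is one of these two, so at some step \<open>M\<close> itself is normal in
  \<open>carrier G\<close>. The equation for \<open>L\<close> is a premise so that the induction can
  let \<open>L\<close> vary.\<close>

lemma (in group) maximal_subnormal_imp_normal:
  assumes "subnormal_in G M L" "maximal_subgroup G M" "L = carrier G"
  shows "M \<lhd> G"
  using assms
proof (induction rule: subnormal_in.induct)
  case (refl H)
  then show ?case by (simp add: maximal_subgroup_def)
next
  case (step H K L)
  have "H \<subseteq> K" "subgroup K G" using subnormal_in_subgroup[OF step(1)] by auto
  then have "K = H \<or> K = carrier G" using step.prems by (simp add: maximal_subgroup_def)
  then show ?case using step by auto
qed

text \<open>The join of \<open>M\<close> and \<open>R\<close> is \<open>M\<close> or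
  \<open>carrier G\<close>. In the first case the condition is void, in the second it asks
  \<open>M\<close> to be subnormal, hence normal. Both halves of the theorem use
  \<open>R_subnormal\<close> only through this dichotomy.\<close>

lemma (in group) R_subnormal_maximal_iff:
  assumes "maximal_subgroup G M" "R \<subseteq> carrier G"
  shows "R_subnormal G R M \<longleftrightarrow> R \<subseteq> M \<or> M \<lhd> G"
proof -
  have M: "subgroup M G" using assms by (simp add: maximal_subgroup_def)
  let ?J = "generate G (M \<union> R)"
  have J: "subgroup ?J G" "M \<subseteq> ?J" "R \<subseteq> ?J"
    using assms(2) subgroup.subset[OF M] generate_is_subgroup[of "M \<union> R"] generate.incl[of _ "M \<union> R" G] by auto
  show ?thesis
  proof (cases "R \<subseteq> M")
    case True
    then have "M \<union> R = M" by auto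
    then have "?J = M" using generateI[OF M, of M] by (metis M generate_subgroup_incl generate.incl subsetI subset_antisym order_refl)
    then show ?thesis using True M by (simp add: R_subnormal_def subnormal_in.refl)
  next
    case False
    then have "?J \<noteq> M" using J by auto
    then have "?J = carrier G" using J assms by (auto simp: maximal_subgroup_def)
    moreover have "subnormal_in G M (carrier G)" if "M \<lhd> G"
      by (rule subnormal_in.step[OF subnormal_in.refl[OF M] subgroup_self]) (use that in simp)
    ultimately show ?thesis
      using False M maximal_subnormal_imp_normal[OF _ assms(1)] by (auto simp: R_subnormal_def)
  qed
qed

text \<open>Preimage of the centralizer of \<open>a\<close>. With a quotient map for
  \<open>h\<close> it collects the elements commuting with a given coset; with the identity it is
  the usual centralizer.\<close>

lemma (in group_hom) subgroup_commuting_image: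
  assumes "a \<in> carrier H"
  shows "subgroup {y \<in> carrier G. h y \<otimes>\<^bsub>H\<^esub> a = a \<otimes>\<^bsub>H\<^esub> h y} G"
proof (rule G.subgroupI)
  fix y assume "y \<in> {y \<in> carrier G. h y \<otimes>\<^bsub>H\<^esub> a = a \<otimes>\<^bsub>H\<^esub> h y}"
  then have y: "y \<in> carrier G" "h y \<otimes>\<^bsub>H\<^esub> a = a \<otimes>\<^bsub>H\<^esub> h y" by auto
  have "inv\<^bsub>H\<^esub> h y \<otimes>\<^bsub>H\<^esub> a = inv\<^bsub>H\<^esub> h y \<otimes>\<^bsub>H\<^esub> (a \<otimes>\<^bsub>H\<^esub> h y) \<otimes>\<^bsub>H\<^esub> inv\<^bsub>H\<^esub> h y"
    using y(1) assms by (simp add: H.m_assoc)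
  also have "\<dots> = a \<otimes>\<^bsub>H\<^esub> inv\<^bsub>H\<^esub> h y"
    unfolding y(2)[symmetric] using y(1) assms by (simp add: H.m_assoc[symmetric])
  finally show "inv y \<in> {y \<in> carrier G. h y \<otimes>\<^bsub>H\<^esub> a = a \<otimes>\<^bsub>H\<^esub> h y}" using y(1) by simp
next
  fix x y assume "x \<in> {y \<in> carrier G. h y \<otimes>\<^bsub>H\<^esub> a = a \<otimes>\<^bsub>H\<^esub> h y}"
    and "y \<in> {y \<in> carrier G. h y \<otimes>\<^bsub>H\<^esub> a = a \<otimes>\<^bsub>H\<^esub> h y}"
  then show "x \<otimes> y \<in> {y \<in> carrier G. h y \<otimes>\<^bsub>H\<^esub> a = a \<otimes>\<^bsub>H\<^esub> h y}"
    using assms by (auto simp: H.m_assoc) (metis H.m_assoc hom_closed)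
qed (use assms in auto)

lemma (in group) subgroup_commuting:
  assumes "a \<in> carrier G"
  shows "subgroup {y \<in> carrier G. y \<otimes> a = a \<otimes> y} G"
proof -
  have "group_hom G G (\<lambda>x. x)" by (simp add: group_hom_def group_hom_axioms_def hom_def)
  from group_hom.subgroup_commuting_image[OF this assms] show ?thesis .
qed

lemma (in normal) group_hom_Mod: "group_hom G (G Mod H) (\<lambda>x. H #> x)"
  using r_coset_hom_Mod by (simp add: group_hom_def group_hom_axioms_def factorgroup_is_group)

lemma (in normal) r_coset_eq_iff: "x \<in> carrier G \<Longrightarrow> H #> x = H \<longleftrightarrow> x \<in> H"
  using coset_join1[OF _ _ subgroup_axioms] coset_join2[OF _ subgroup_axioms] subset by blast

lemma (in group) commutator_eq_one_iff:
  assumes "x \<in> carrier G" "y \<in> carrier G"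
  shows "x \<otimes> y \<otimes> inv x \<otimes> inv y = \<one> \<longleftrightarrow> x \<otimes> y = y \<otimes> x"
proof
  assume "x \<otimes> y \<otimes> inv x \<otimes> inv y = \<one>"
  moreover have "(x \<otimes> y \<otimes> inv x \<otimes> inv y) \<otimes> (y \<otimes> x) = x \<otimes> y"
    using assms by (simp add: m_assoc inv_cancel_left)
  ultimately show "x \<otimes> y = y \<otimes> x" using assms by simp
next
  assume "x \<otimes> y = y \<otimes> x"
  then show "x \<otimes> y \<otimes> inv x \<otimes> inv y = \<one>" using assms by (simp add: m_assoc inv_cancel_left)
qed

lemma (in normal) commutator_mem_iff:
  assumes "x \<in> carrier G" "y \<in> carrier G"
  shows "x \<otimes> y \<otimes> inv x \<otimes> inv y \<in> H \<longleftrightarrow>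
    (H #> x) \<otimes>\<^bsub>G Mod H\<^esub> (H #> y) = (H #> y) \<otimes>\<^bsub>G Mod H\<^esub> (H #> x)"
proof -
  interpret q: group_hom G "G Mod H" "\<lambda>x. H #> x" by (rule group_hom_Mod)
  have "H #> (x \<otimes> y \<otimes> inv x \<otimes> inv y) =
    (H #> x) \<otimes>\<^bsub>G Mod H\<^esub> (H #> y) \<otimes>\<^bsub>G Mod H\<^esub> inv\<^bsub>G Mod H\<^esub> (H #> x) \<otimes>\<^bsub>G Mod H\<^esub> inv\<^bsub>G Mod H\<^esub> (H #> y)"
    using assms by (simp del: mult_FactGroup)
  then show ?thesis
    using r_coset_eq_iff[of "x \<otimes> y \<otimes> inv x \<otimes> inv y"] assms
      q.H.commutator_eq_one_iff[OF q.hom_closed q.hom_closed, OF assms]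
    by (simp del: mult_FactGroup)
qed

text \<open>The quotient \<open>G Mod M\<close> is abelian: for \<open>a\<close> outside
  \<open>M\<close>, the elements commuting with \<open>a\<close> modulo \<open>M\<close> form a
  subgroup containing \<open>M\<close> and \<open>a\<close>, which by maximality is
  everything.\<close>

lemma (in group) derived_subset_normal_maximal:
  assumes "maximal_subgroup G M" "M \<lhd> G"
  shows "derived G (carrier G) \<subseteq> M"
proof -
  interpret M: normal M G by fact
  interpret q: group_hom G "G Mod M" "\<lambda>x. M #> x" by (rule M.group_hom_Mod)
  have comm: "(M #> y) \<otimes>\<^bsub>G Mod M\<^esub> (M #> a) = (M #> a) \<otimes>\<^bsub>G Mod M\<^esub> (M #> y)"
    if a: "a \<in> carrier G" and y: "y \<in> carrier G" for a y
  proof (cases "a \<in> M")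
    case True
    then have "M #> a = \<one>\<^bsub>G Mod M\<^esub>" using M.r_coset_eq_iff[OF a] by simp
    then show ?thesis using q.H.l_one[of "M #> y"] q.H.r_one[of "M #> y"] q.hom_closed[OF y] by presburger
  next
    case False
    let ?T = "{y \<in> carrier G. (M #> y) \<otimes>\<^bsub>G Mod M\<^esub> (M #> a) = (M #> a) \<otimes>\<^bsub>G Mod M\<^esub> (M #> y)}"
    have T: "subgroup ?T G" using q.subgroup_commuting_image q.hom_closed[OF a] by blast
    have "M \<subseteq> ?T"
    proof
      fix m assume "m \<in> M"
      then have "m \<in> carrier G" "M #> m = \<one>\<^bsub>G Mod M\<^esub>" using M.r_coset_eq_iff by auto
      then show "m \<in> ?T"
        using q.H.l_one[of "M #> a"] q.H.r_one[of "M #> a"] q.hom_closed[OF a] by (simp del: mult_FactGroup one_FactGroup)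
    qed
    moreover have "a \<in> ?T" using a by simp
    ultimately have "?T = carrier G" using T assms(1) False unfolding maximal_subgroup_def by blast
    then show ?thesis using y by blast
  qed
  have "derived_set G (carrier G) \<subseteq> M"
  proof clarsimp
    fix x y assume x: "x \<in> carrier G" and y: "y \<in> carrier G"
    show "x \<otimes> y \<otimes> inv x \<otimes> inv y \<in> M"
      by (rule M.commutator_mem_iff[OF x y, THEN iffD2, OF comm[OF y x]])
  qed
  then show ?thesis unfolding derived_def by (rule generate_subgroup_incl[OF _ M.subgroup_axioms])
qed

lemma (in group) normal_if_derived_subset:
  assumes "subgroup M G" "derived G (carrier G) \<subseteq> M"
  shows "M \<lhd> G"
  unfolding normal_inv_iff
proof (intro conjI ballI)
  interpret M: subgroup M G by fact
  fix x h assume x: "x \<in> carrier G" and h: "h \<in> M"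
  have "x \<otimes> h \<otimes> inv x \<otimes> inv h \<in> derived G (carrier G)"
    unfolding derived_def using x M.mem_carrier[OF h] by (intro generate.incl) blast
  then have "(x \<otimes> h \<otimes> inv x \<otimes> inv h) \<otimes> h \<in> M" using assms(2) h by auto
  then show "x \<otimes> h \<otimes> inv x \<in> M" using x h by (simp add: m_assoc)
qed (rule assms)

section \<open>Conjugates of maximal subgroups and normality of the Frattini subgroup\<close>

lemma (in group) subgroup_conj_image:
  assumes "subgroup H G" "g \<in> carrier G"
  shows "subgroup ((\<lambda>h. g \<otimes> h \<otimes> inv g) ` H) G"
proof -
  interpret H: subgroup H G by fact
  have "(\<lambda>h. g \<otimes> h \<otimes> inv g) \<in> hom G G"
    using assms(2) by (intro homI) (simp_all add: m_assoc inv_cancel_left)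
  then interpret c: group_hom G G "\<lambda>h. g \<otimes> h \<otimes> inv g"
    by (simp add: group_hom_def group_hom_axioms_def)
  show ?thesis by (rule c.subgroup_img_is_subgroup[OF assms(1)])
qed

lemma (in group) maximal_subgroup_conj_image:
  assumes "maximal_subgroup G M" "g \<in> carrier G"
  shows "maximal_subgroup G ((\<lambda>h. g \<otimes> h \<otimes> inv g) ` M)"
proof -
  let ?c = "\<lambda>g h. g \<otimes> h \<otimes> inv g"
  have M: "subgroup M G" "M \<subseteq> carrier G"
    using assms(1) subgroup.subset by (auto simp: maximal_subgroup_def)
  have cc: "?c (inv g) ` ?c g ` K = K" "?c g ` ?c (inv g) ` K = K" if "K \<subseteq> carrier G" for K
  proof -
    have "?c (inv g) (?c g k) = k" "?c g (?c (inv g) k) = k" if "k \<in> K" for k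
      using that assms(2) \<open>K \<subseteq> carrier G\<close> by (simp_all add: m_assoc subset_iff inv_cancel_left)
    then show "?c (inv g) ` ?c g ` K = K" "?c g ` ?c (inv g) ` K = K" by (auto simp: image_image)
  qed
  have ccar: "?c (inv g) ` carrier G = carrier G"
  proof
    have "?c g ` carrier G \<subseteq> carrier G" using assms(2) by auto
    then show "carrier G \<subseteq> ?c (inv g) ` carrier G" using image_mono cc(1)[of "carrier G"] by blast
  qed (use assms(2) in auto)
  have ccar': "?c g ` carrier G = carrier G" using cc(2)[of "carrier G"] ccar by simp
  show ?thesis unfolding maximal_subgroup_def
  proof (intro conjI allI impI)
    show "subgroup (?c g ` M) G" by (rule subgroup_conj_image[OF M(1) assms(2)])
    show "?c g ` M \<noteq> carrier G"
      using cc(1)[OF M(2)] ccar assms(1) by (auto simp: maximal_subgroup_def)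
    fix K assume K: "subgroup K G" "?c g ` M \<subseteq> K"
    have "M \<subseteq> ?c (inv g) ` K" using K(2) cc(1)[OF M(2)] by (metis image_mono)
    then have "?c (inv g) ` K = M \<or> ?c (inv g) ` K = carrier G"
      using assms subgroup_conj_image[OF K(1) inv_closed] by (auto simp: maximal_subgroup_def)
    then show "K = ?c g ` M \<or> K = carrier G"
      using cc(2)[OF subgroup.subset[OF K(1)]] ccar' by metis
  qed
qed

lemma (in group) frattini_normal: "frattini G \<lhd> G"
  unfolding normal_inv_iff
proof (intro conjI ballI)
  \<comment> \<open>Inserting \<open>carrier G\<close> keeps the family nonempty even if there is no
    maximal subgroup.\<close>
  have "frattini G = \<Inter> (insert (carrier G) {M. maximal_subgroup G M})"
    by (auto simp: frattini_def)
  then show "subgroup (frattini G) G"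
    by (metis (no_types, lifting) subgroups_Inter insert_iff insert_not_empty maximal_subgroup_def mem_Collect_eq subgroup_self)
next
  fix x h assume x: "x \<in> carrier G" and h: "h \<in> frattini G"
  have h': "h \<in> carrier G" using h by (simp add: frattini_def)
  have "x \<otimes> h \<otimes> inv x \<in> M" if M: "maximal_subgroup G M" for M
  proof -
    \<comment> \<open>The conjugate of \<open>M\<close> by \<open>inv x\<close> is again maximal, so
      it contains \<open>h\<close>; conjugating back by \<open>x\<close> lands in
      \<open>M\<close>.\<close>
    have "h \<in> (\<lambda>k. inv x \<otimes> k \<otimes> inv (inv x)) ` M"
      using h maximal_subgroup_conj_image[OF M inv_closed[OF x]] by (auto simp: frattini_def)
    then obtain m where "m \<in> M" "h = inv x \<otimes> m \<otimes> x" using x by auto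
    moreover from this have "m \<in> carrier G" using M by (auto simp: maximal_subgroup_def dest: subgroup.subset)
    ultimately have "x \<otimes> h \<otimes> inv x = m" using x by (simp add: m_assoc inv_cancel_left)
    with \<open>m \<in> M\<close> show ?thesis by simp
  qed
  then show "x \<otimes> h \<otimes> inv x \<in> frattini G" using x h' by (auto simp: frattini_def)
qed

lemma (in group) socle_subset: "socle G \<subseteq> carrier G"
  unfolding socle_def
  by (rule generate_incl) (use normal_imp_subgroup subgroup.subset in \<open>fastforce simp: minimal_normal_def\<close>)

lemma (in group) F_tilde_subset: "F_tilde G \<subseteq> carrier G"
proof -
  interpret F: normal "frattini G" G by (rule frattini_normal)
  interpret Q: group "G Mod frattini G" by (rule F.factorgroup_is_group)
  have "socle (G Mod frattini G) \<subseteq> rcosets (frattini G)"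
    using Q.socle_subset by (simp add: FactGroup_def)
  then show ?thesis unfolding F_tilde_def using rcosets_part_G[OF F.subgroup_axioms] by blast
qed

text \<open>The contradiction is carried by one element \<open>x\<close> that lies both in the
  derived subgroup and in \<open>F_tilde G\<close> but misses some maximal subgroup
  \<open>M\<close>. Since \<open>F_tilde G\<close> is not inside \<open>M\<close>, the hypothesis
  makes \<open>M\<close> normal, and then \<open>M\<close> contains the derived subgroup and with it
  \<open>x\<close>.\<close>

lemma (in group) derived_subset_frattini:
  assumes "finite (carrier G)"
    and sub: "\<And>M. maximal_subgroup G M \<Longrightarrow> R_subnormal G (F_tilde G) M"
  shows "derived G (carrier G) \<subseteq> frattini G"
proof (rule ccontr)
  let ?F = "frattini G"
  let ?Q = "G Mod ?F"
  assume neg: "\<not> derived G (carrier G) \<subseteq> ?F"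
  interpret F: normal ?F G by (rule frattini_normal)
  interpret q: group_hom G ?Q "\<lambda>x. ?F #> x" by (rule F.group_hom_Mod)
  have car: "carrier ?Q = (\<lambda>x. ?F #> x) ` carrier G" by (rule carrier_FactGroup)
  have der: "derived ?Q (carrier ?Q) = (\<lambda>x. ?F #> x) ` derived G (carrier G)"
    unfolding car by (rule q.derived_img) simp
  obtain d where d: "d \<in> derived G (carrier G)" "d \<notin> ?F" using neg by blast
  have dc: "d \<in> carrier G" using d(1) derived_in_carrier[of "carrier G"] by auto
  have "derived ?Q (carrier ?Q) \<noteq> {\<one>\<^bsub>?Q\<^esub>}"
    using der d F.r_coset_eq_iff[OF dc] by auto
  moreover have "derived ?Q (carrier ?Q) \<lhd> ?Q" by (rule q.H.derived_is_normal[OF q.H.normal_self])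
  moreover have "finite (carrier ?Q)" using assms(1) car by simp
  ultimately obtain N where N: "minimal_normal ?Q N" "N \<subseteq> derived ?Q (carrier ?Q)"
    using q.H.minimal_normal_exists by blast
  have Ns: "subgroup N ?Q" "N \<noteq> {\<one>\<^bsub>?Q\<^esub>}" using N(1) by (auto simp: minimal_normal_def normal_imp_subgroup)
  then obtain C where C: "C \<in> N" "C \<noteq> \<one>\<^bsub>?Q\<^esub>" using subgroup.one_closed by blast
  then obtain x where x: "x \<in> derived G (carrier G)" "C = ?F #> x" using N(2) der by blast
  have xc: "x \<in> carrier G" using x(1) derived_in_carrier[of "carrier G"] by auto
  have "x \<notin> ?F" using C x F.r_coset_eq_iff[OF xc] by auto
  then obtain M where M: "maximal_subgroup G M" "x \<notin> M" using xc by (auto simp: frattini_def)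
  have "C \<in> socle ?Q" unfolding socle_def using C N by (intro generate.incl) auto
  then have "x \<in> F_tilde G" unfolding F_tilde_def
    using rcos_self[OF xc F.subgroup_axioms] x(2) by auto
  then have "M \<lhd> G" using sub[OF M(1)] M R_subnormal_maximal_iff[OF M(1) F_tilde_subset] by auto
  then show False using derived_subset_normal_maximal[OF M(1)] x(1) M(2) by blast
qed

lemma (in group) lower_central_subgroup: "subgroup (lower_central G n) G"
proof (induction n)
  case (Suc n)
  interpret L: subgroup "lower_central G n" G by fact
  show ?case unfolding lower_central.simps commutator_def
    by (rule generate_is_subgroup) auto
qed (simp add: subgroup_self)

lemma lower_central_Suc_memI:
  "x \<in> lower_central G n \<Longrightarrow> y \<in> carrier G \<Longrightarrow> x \<otimes>\<^bsub>G\<^esub> y \<otimes>\<^bsub>G\<^esub> inv\<^bsub>G\<^esub> x \<otimes>\<^bsub>G\<^esub> inv\<^bsub>G\<^esub> y \<in> lower_central G (Suc n)"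
  unfolding lower_central.simps commutator_def by (rule generate.incl) blast

section \<open>Nilpotency of groups whose maximal subgroups are normal\<close>

text \<open>Orbit counting: the orbit of a point that is not fixed has size a power of
  \<open>p\<close> greater than 1, so the number of such points is a multiple of \<open>p\<close>.
  The action is given by bare laws, so that translation of cosets and conjugation both fit
  directly.\<close>

lemma p_group_fixed_points_cong:
  assumes "group P" "card (carrier P) = p ^ a" "Factorial_Ring.prime p" "finite E"
    and closed: "\<And>g x. g \<in> carrier P \<Longrightarrow> x \<in> E \<Longrightarrow> act g x \<in> E"
    and one: "\<And>x. x \<in> E \<Longrightarrow> act \<one>\<^bsub>P\<^esub> x = x"
    and mult: "\<And>g h x. g \<in> carrier P \<Longrightarrow> h \<in> carrier P \<Longrightarrow> x \<in> E \<Longrightarrow> act (g \<otimes>\<^bsub>P\<^esub> h) x = act g (act h x)"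
  shows "p dvd card E \<longleftrightarrow> p dvd card {x \<in> E. \<forall>g\<in>carrier P. act g x = x}"
proof -
  interpret P: group P by fact
  let ?\<phi> = "\<lambda>g. restrict (act g) E"
  have bij: "?\<phi> g \<in> Bij E" if g: "g \<in> carrier P" for g
  proof -
    have "act (inv\<^bsub>P\<^esub> g) (act g x) = x" "act g (act (inv\<^bsub>P\<^esub> g) x) = x" if "x \<in> E" for x
      using mult[of "inv\<^bsub>P\<^esub> g" g x] mult[of g "inv\<^bsub>P\<^esub> g" x] g one that by auto
    then have "bij_betw (act g) E E"
      by (intro bij_betwI[of _ _ _ "act (inv\<^bsub>P\<^esub> g)"]) (use g closed in auto)
    then show ?thesis by (simp add: Bij_def bij_betw_restrict_eq)
  qed
  have "?\<phi> \<in> hom P (BijGroup E)"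
  proof (rule homI)
    fix g h assume gh: "g \<in> carrier P" "h \<in> carrier P"
    show "?\<phi> (g \<otimes>\<^bsub>P\<^esub> h) = ?\<phi> g \<otimes>\<^bsub>BijGroup E\<^esub> ?\<phi> h"
      using gh bij by (auto simp: BijGroup_def compose_def restrict_def mult closed fun_eq_iff)
  qed (simp add: BijGroup_def bij)
  then interpret A: group_action P E ?\<phi>
    by (simp add: group_action_def group_hom_def group_hom_axioms_def group_BijGroup P.is_group)
  let ?F = "{x \<in> E. \<forall>g\<in>carrier P. act g x = x}"
  let ?O = "orbit P ?\<phi>"
  have O: "?O x = (\<lambda>g. act g x) ` carrier P" if "x \<in> E" for x
    using that by (auto simp: orbit_def)
  have dvd: "p dvd card (\<Union> (?O ` (E - ?F)))"
  proof (rule dvd_partition)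
    have "?O x \<subseteq> E" if "x \<in> E" for x using that closed O by auto
    then have "\<Union> (?O ` (E - ?F)) \<subseteq> E" by blast
    then show "finite (\<Union> (?O ` (E - ?F)))" using assms(4) by (rule finite_subset)
    show "\<forall>c\<in>?O ` (E - ?F). p dvd card c"
    proof
      fix c assume "c \<in> ?O ` (E - ?F)"
      then obtain x where x: "x \<in> E" "x \<notin> ?F" "c = ?O x" by auto
      have "card c * card (stabilizer P ?\<phi> x) = p ^ a"
        using A.orbit_stabilizer_theorem[OF x(1)] x(3) assms(2) by (simp add: order_def)
      then have "card c dvd p ^ a" by (metis dvd_triv_left)
      then obtain k where k: "card c = p ^ k" using divides_primepow_nat[OF assms(3)] by auto
      have "k \<noteq> 0"
      proof
        assume "k = 0"
        then obtain y where "c = {y}" using k card_1_singletonE by auto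
        moreover have "x \<in> c" using A.orbit_refl x by simp
        ultimately have "act g x = x" if "g \<in> carrier P" for g using O[OF x(1)] x(3) that by auto
        then show False using x by blast
      qed
      then show "p dvd card c" using k by simp
    qed
    show "\<forall>c1\<in>?O ` (E - ?F). \<forall>c2\<in>?O ` (E - ?F). c1 \<noteq> c2 \<longrightarrow> c1 \<inter> c2 = {}"
    proof (intro ballI impI)
      fix c1 c2 assume "c1 \<in> ?O ` (E - ?F)" "c2 \<in> ?O ` (E - ?F)" "c1 \<noteq> c2"
      moreover from this have "c1 \<in> orbits P E ?\<phi>" "c2 \<in> orbits P E ?\<phi>" by (auto simp: orbits_def)
      ultimately show "c1 \<inter> c2 = {}"
        using A.disjoint_union by blast
    qed
  qed
  have un: "\<Union> (?O ` (E - ?F)) = E - ?F"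
  proof
    show "E - ?F \<subseteq> \<Union> (?O ` (E - ?F))" using A.orbit_refl by blast
    show "\<Union> (?O ` (E - ?F)) \<subseteq> E - ?F"
    proof
      fix y assume "y \<in> \<Union> (?O ` (E - ?F))"
      then obtain x where x: "x \<in> E" "x \<notin> ?F" "y \<in> ?O x" by auto
      have y: "y \<in> E" using x O closed by auto
      have "x \<in> ?O y" using A.orbit_sym[OF x(1) y x(3)] .
      then have "y \<in> ?F \<Longrightarrow> x \<in> ?F" using O[OF y] by auto
      with x y show "y \<in> E - ?F" by blast
    qed
  qed
  have "card E = card (E \<inter> ?F) + card (E - ?F)" by (rule card_Int_Diff[OF assms(4)])
  also have "E \<inter> ?F = ?F" by blast
  finally have eq: "card E = card ?F + card (E - ?F)" .
  show ?thesis unfolding eq by (rule dvd_add_left_iff[OF dvd[unfolded un]])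
qed

section \<open>Sylow subgroups: conjugacy and normality\<close>

lemma (in group) card_subgroup_dvd:
  assumes "subgroup H G" "subgroup K G" "H \<subseteq> K"
  shows "card H dvd card K"
proof -
  interpret K: group "G\<lparr>carrier := K\<rparr>" by (rule subgroup.subgroup_is_group[OF assms(2) is_group])
  have "card (rcosets\<^bsub>G\<lparr>carrier := K\<rparr>\<^esub> H) * card H = card K"
    using K.lagrange[OF subgroup_incl[OF assms]] by (simp add: order_def)
  then show ?thesis by (metis dvd_triv_right)
qed

text \<open>Let \<open>Q\<close> act on the right cosets of \<open>P\<close> by right multiplication
  with inverses. Their number \<open>m\<close> is prime to \<open>p\<close>, so some coset of
  \<open>x\<close> is fixed. This puts \<open>Q\<close> inside the conjugate of \<open>P\<close> by
  \<open>inv x\<close>, and the orders agree.\<close>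

lemma (in group) sylow_conjugate:
  assumes "finite (carrier G)" "Factorial_Ring.prime p" "order G = p ^ a * m" "\<not> p dvd m"
    and "subgroup P G" "card P = p ^ a" "subgroup Q G" "card Q = p ^ a"
  obtains g where "g \<in> carrier G" "Q = (\<lambda>h. g \<otimes> h \<otimes> inv g) ` P"
proof -
  interpret P: subgroup P G by fact
  interpret Q: subgroup Q G by fact
  let ?act = "\<lambda>g C. C #> inv g"
  let ?F = "{C \<in> rcosets P. \<forall>g\<in>carrier (G\<lparr>carrier := Q\<rparr>). ?act g C = C}"
  have "card (rcosets P) * p ^ a = p ^ a * m" using lagrange[OF assms(5)] assms by simp
  then have "card (rcosets P) = m" using prime_gt_0_nat[OF assms(2)] by simp
  moreover have "p dvd card (rcosets P) \<longleftrightarrow> p dvd card ?F"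
  proof (rule p_group_fixed_points_cong[of _ p a])
    show "group (G\<lparr>carrier := Q\<rparr>)" by (rule Q.subgroup_is_group[OF is_group])
    show "finite (rcosets P)" using assms(1) by (simp add: RCOSETS_def)
    show "C #> inv g \<in> rcosets P" if "g \<in> carrier (G\<lparr>carrier := Q\<rparr>)" "C \<in> rcosets P" for g C
    proof -
      from that obtain x where "x \<in> carrier G" "C = P #> x" by (auto simp: RCOSETS_def)
      then show ?thesis using that coset_mult_assoc[OF P.subset] rcosetsI[OF P.subset, of "x \<otimes> inv g"] by simp
    qed
    show "C #> inv \<one>\<^bsub>G\<lparr>carrier := Q\<rparr>\<^esub> = C" if "C \<in> rcosets P" for C
      using P.rcosets_carrier[OF is_group that] by simp
    show "C #> inv (g \<otimes>\<^bsub>G\<lparr>carrier := Q\<rparr>\<^esub> h) = C #> inv h #> inv g"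
      if "g \<in> carrier (G\<lparr>carrier := Q\<rparr>)" "h \<in> carrier (G\<lparr>carrier := Q\<rparr>)" "C \<in> rcosets P" for g h C
      using that P.rcosets_carrier[OF is_group] by (simp add: coset_mult_assoc inv_mult_group)
  qed (use assms in auto)
  ultimately have "card ?F \<noteq> 0" using assms(4) by (metis dvd_0_right)
  then obtain C where "C \<in> ?F" by (metis (no_types, lifting) card.empty equals0I)
  then obtain x where x: "x \<in> carrier G" "\<And>g. g \<in> Q \<Longrightarrow> P #> x #> inv g = P #> x"
    by (auto simp: RCOSETS_def)
  have "Q \<subseteq> (\<lambda>h. inv x \<otimes> h \<otimes> inv (inv x)) ` P"
  proof
    fix g assume g: "g \<in> Q"
    then have gc: "g \<in> carrier G" by simp
    have "P #> (x \<otimes> g) = P #> x" using x(2)[of "inv g"] g gc x(1) by (simp add: coset_mult_assoc P.subset)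
    then have "x \<otimes> g \<in> P #> x" using rcos_self[OF _ assms(5), of "x \<otimes> g"] gc x(1) by auto
    then obtain h where h: "h \<in> P" "x \<otimes> g = h \<otimes> x" by (auto simp: r_coset_def)
    then have "g = inv x \<otimes> h \<otimes> inv (inv x)"
      using x(1) gc inv_cancel_left(1)[OF x(1) gc] by (simp add: m_assoc)
    with h(1) show "g \<in> (\<lambda>h. inv x \<otimes> h \<otimes> inv (inv x)) ` P" by blast
  qed
  moreover have finP: "finite P" using assms(1) P.subset finite_subset by blast
  moreover have "card ((\<lambda>h. inv x \<otimes> h \<otimes> inv (inv x)) ` P) \<le> card Q"
    using card_image_le[OF finP] assms by metis
  ultimately have "Q = (\<lambda>h. inv x \<otimes> h \<otimes> inv (inv x)) ` P"
    by (intro card_seteq) auto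
  then show ?thesis by (rule that[OF inv_closed[OF x(1)]])
qed

lemma (in group) conj_image_mult:
  assumes "g \<in> carrier G" "k \<in> carrier G" "A \<subseteq> carrier G"
  shows "(\<lambda>h. (g \<otimes> k) \<otimes> h \<otimes> inv (g \<otimes> k)) ` A = (\<lambda>h. g \<otimes> h \<otimes> inv g) ` (\<lambda>h. k \<otimes> h \<otimes> inv k) ` A"
  unfolding image_image by (rule image_cong) (use assms in \<open>auto simp: m_assoc inv_mult_group subset_iff\<close>)

lemma (in group) conj_image_one: "A \<subseteq> carrier G \<Longrightarrow> (\<lambda>h. \<one> \<otimes> h \<otimes> inv \<one>) ` A = A"
  by (force simp: subset_iff)

lemma (in group) subgroup_conj_fixing:
  assumes "A \<subseteq> carrier G"
  shows "subgroup {g \<in> carrier G. (\<lambda>h. g \<otimes> h \<otimes> inv g) ` A = A} G"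
proof (rule subgroupI)
  fix g assume "g \<in> {g \<in> carrier G. (\<lambda>h. g \<otimes> h \<otimes> inv g) ` A = A}"
  then have g: "g \<in> carrier G" "(\<lambda>h. g \<otimes> h \<otimes> inv g) ` A = A" by auto
  have "(\<lambda>h. inv g \<otimes> h \<otimes> inv (inv g)) ` A = A"
    using conj_image_mult[of "inv g" g A] g assms conj_image_one[OF assms] by simp
  with g show "inv g \<in> {g \<in> carrier G. (\<lambda>h. g \<otimes> h \<otimes> inv g) ` A = A}" by simp
next
  fix g k assume "g \<in> {g \<in> carrier G. (\<lambda>h. g \<otimes> h \<otimes> inv g) ` A = A}"
    "k \<in> {g \<in> carrier G. (\<lambda>h. g \<otimes> h \<otimes> inv g) ` A = A}"
  then show "g \<otimes> k \<in> {g \<in> carrier G. (\<lambda>h. g \<otimes> h \<otimes> inv g) ` A = A}"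
    using conj_image_mult[of g k A] assms by simp
next
  show "{g \<in> carrier G. (\<lambda>h. g \<otimes> h \<otimes> inv g) ` A = A} \<noteq> {}"
    using conj_image_one[OF assms] by blast
qed auto

text \<open>Frattini argument. If the normalizer \<open>?N\<close> of \<open>P\<close> were proper,
  it would lie in a maximal, hence normal, subgroup \<open>M\<close>. Every conjugate of
  \<open>P\<close> by some \<open>g\<close> lies in \<open>M\<close> and is conjugate to
  \<open>P\<close> by some \<open>x\<close> in \<open>M\<close>, so \<open>inv x \<otimes> g\<close>
  normalizes \<open>P\<close> and \<open>g\<close> lies in \<open>M\<close>.\<close>

lemma (in group) sylow_normal:
  assumes "finite (carrier G)" "\<And>M. maximal_subgroup G M \<Longrightarrow> M \<lhd> G"
    and "Factorial_Ring.prime p" "order G = p ^ a * m" "\<not> p dvd m" "subgroup P G" "card P = p ^ a"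
  shows "P \<lhd> G"
proof -
  interpret P: subgroup P G by fact
  let ?N = "{g \<in> carrier G. (\<lambda>h. g \<otimes> h \<otimes> inv g) ` P = P}"
  have N: "subgroup ?N G" by (rule subgroup_conj_fixing[OF P.subset])
  have P_sub: "P \<subseteq> ?N"
  proof
    fix g assume g: "g \<in> P"
    have "h \<in> (\<lambda>h. g \<otimes> h \<otimes> inv g) ` P" if "h \<in> P" for h
      by (rule image_eqI[of _ _ "inv g \<otimes> h \<otimes> g"]) (use g that in \<open>auto simp: m_assoc inv_cancel_left\<close>)
    then show "g \<in> ?N" using g by auto
  qed
  have "?N = carrier G"
  proof (rule ccontr)
    assume "?N \<noteq> carrier G"
    then obtain M where M: "maximal_subgroup G M" "?N \<subseteq> M"
      using maximal_subgroup_exists[OF assms(1) N] by blast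
    interpret M: normal M G by (rule assms(2)[OF M(1)])
    interpret M': group "G\<lparr>carrier := M\<rparr>" by (rule M.subgroup_is_group[OF is_group])
    have PM: "subgroup P (G\<lparr>carrier := M\<rparr>)"
      by (rule subgroup_incl[OF assms(6) M.subgroup_axioms subset_trans[OF P_sub M(2)]])
    have finM: "finite M" using M.subset assms(1) finite_subset by blast
    have "p ^ a dvd card M"
      using card_subgroup_dvd[OF assms(6) M.subgroup_axioms subset_trans[OF P_sub M(2)]] assms(7) by simp
    then obtain m' where m': "card M = p ^ a * m'" by blast
    have "card M dvd order G" using lagrange[OF M.subgroup_axioms] by (metis dvd_triv_right)
    \<comment> \<open>The cofactor of \<open>p ^ a\<close> in the order of \<open>M\<close> is still
      prime to \<open>p\<close>, so \<open>P\<close> is a Sylow subgroup of \<open>M\<close>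
      too.\<close>
    then have "m' dvd m" using m' assms(4) prime_gt_0_nat[OF assms(3)] by simp
    then have "\<not> p dvd m'" using assms(5) dvd_trans by blast
    have "g \<in> M" if g: "g \<in> carrier G" for g
    proof -
      let ?Q = "(\<lambda>h. g \<otimes> h \<otimes> inv g) ` P"
      have "inj_on (\<lambda>h. g \<otimes> h \<otimes> inv g) P" using g by (auto simp: inj_on_def)
      then have cQ: "card ?Q = p ^ a" using assms(7) by (simp add: card_image)
      have "?Q \<subseteq> M" using M.inv_op_closed2[OF g] subset_trans[OF P_sub M(2)] by (simp add: image_subset_iff subset_eq)
      then have "subgroup ?Q (G\<lparr>carrier := M\<rparr>)"
        by (rule subgroup_incl[OF subgroup_conj_image[OF assms(6) g] M.subgroup_axioms])
      from M'.sylow_conjugate[OF _ assms(3) _ \<open>\<not> p dvd m'\<close> PM assms(7) this cQ]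
      obtain x where x: "x \<in> M" "?Q = (\<lambda>h. x \<otimes> h \<otimes> inv\<^bsub>G\<lparr>carrier := M\<rparr>\<^esub> x) ` P"
        using finM m' by (auto simp: order_def)
      have Q: "?Q = (\<lambda>h. x \<otimes> h \<otimes> inv x) ` P" using x M.subgroup_axioms by simp
      have xc: "x \<in> carrier G" using x by simp
      have "(\<lambda>h. (inv x \<otimes> g) \<otimes> h \<otimes> inv (inv x \<otimes> g)) ` P = (\<lambda>h. inv x \<otimes> x \<otimes> h \<otimes> inv (inv x \<otimes> x)) ` P"
        unfolding conj_image_mult[OF inv_closed[OF xc] g P.subset] conj_image_mult[OF inv_closed[OF xc] xc P.subset]
        using Q by (rule arg_cong)
      also have "\<dots> = P" using conj_image_one[OF P.subset] xc by simp
      finally have "inv x \<otimes> g \<in> ?N" using xc g by blast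
      then have "inv x \<otimes> g \<in> M" by (rule subsetD[OF M(2)])
      then have "x \<otimes> (inv x \<otimes> g) \<in> M" using x by blast
      then show "g \<in> M" using xc g by (simp add: inv_cancel_left)
    qed
    then show False using M(1) M.subset by (auto simp: maximal_subgroup_def)
  qed
  then show ?thesis unfolding normal_inv_iff using assms(6) by blast
qed

text \<open>The fixed points of conjugation are the central elements. Their number is divisible by
  \<open>p\<close>, and the identity is one of them, so there are others.\<close>

lemma (in group) p_group_center_nontrivial:
  assumes "Factorial_Ring.prime p" "order G = p ^ a" "a > 0"
  obtains z where "z \<in> carrier G" "z \<noteq> \<one>" "\<And>g. g \<in> carrier G \<Longrightarrow> z \<otimes> g = g \<otimes> z"
proof -
  let ?F = "{x \<in> carrier G. \<forall>g\<in>carrier G. g \<otimes> x \<otimes> inv g = x}"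
  have "order G > 0" using assms prime_gt_0_nat by simp
  then have fin: "finite (carrier G)" by (simp add: order_gt_0_iff_finite)
  have "p dvd card (carrier G) \<longleftrightarrow> p dvd card ?F"
    by (rule p_group_fixed_points_cong[of _ p a])
      (use assms fin in \<open>auto simp: order_def m_assoc inv_mult_group\<close>)
  then have "p dvd card ?F" using assms by (simp add: order_def)
  moreover have "\<one> \<in> ?F" by simp
  moreover have "\<not> p dvd 1" using assms(1) not_prime_unit by blast
  ultimately have "?F \<noteq> {\<one>}" by (metis card.empty card_insert_if empty_iff finite.emptyI One_nat_def)
  then obtain z where z: "z \<in> ?F" "z \<noteq> \<one>" using \<open>\<one> \<in> ?F\<close> by blast
  have "z \<otimes> g = g \<otimes> z" if g: "g \<in> carrier G" for g
  proof -
    have "g \<otimes> z \<otimes> inv g \<otimes> g = z \<otimes> g" using z(1) g by simp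
    then show ?thesis using z(1) g by (simp add: m_assoc)
  qed
  with z show ?thesis using that by blast
qed

text \<open>The commutator of \<open>x\<close> and \<open>y\<close> lies in \<open>P\<close> as well
  as in \<open>Q\<close>.\<close>

lemma (in group) normal_disjoint_commute:
  assumes "P \<lhd> G" "Q \<lhd> G" "P \<inter> Q = {\<one>}" "x \<in> P" "y \<in> Q"
  shows "x \<otimes> y = y \<otimes> x"
proof -
  interpret P: normal P G by fact
  interpret Q: normal Q G by fact
  have xy: "x \<in> carrier G" "y \<in> carrier G" using assms by auto
  have "x \<otimes> y \<otimes> inv x \<otimes> inv y \<in> Q" using Q.inv_op_closed2[OF xy(1) assms(5)] assms(5) by blast
  moreover have "x \<otimes> (y \<otimes> inv x \<otimes> inv y) \<in> P" using P.inv_op_closed2[OF xy(2), of "inv x"] assms(4) by blast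
  ultimately have "x \<otimes> y \<otimes> inv x \<otimes> inv y = \<one>" using assms(3) xy by (auto simp: m_assoc)
  then show ?thesis using commutator_eq_one_iff xy by blast
qed

text \<open>All Sylow subgroups are normal. An element \<open>z\<close> that is central in one of
  them commutes with the others by coprimality, so the centralizer of \<open>z\<close> contains a
  Sylow subgroup for every prime and is the whole group.\<close>

lemma (in group) center_nontrivial:
  assumes fin: "finite (carrier G)" and "carrier G \<noteq> {\<one>}"
    and max: "\<And>M. maximal_subgroup G M \<Longrightarrow> M \<lhd> G"
  obtains z where "z \<in> carrier G" "z \<noteq> \<one>" "\<And>g. g \<in> carrier G \<Longrightarrow> z \<otimes> g = g \<otimes> z"
proof -
  let ?n = "order G"
  have pos: "?n > 0" using fin by (simp add: order_gt_0_iff_finite)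
  have ex: "\<exists>P. P \<lhd> G \<and> card P = p ^ multiplicity p ?n" if p: "Factorial_Ring.prime p" for p :: nat
  proof -
    have "\<not> is_unit p" using p not_prime_unit by blast
    with pos obtain m where m: "?n = p ^ multiplicity p ?n * m" "\<not> p dvd m"
      using multiplicity_decompose'[of ?n p] by auto
    obtain P where "subgroup P G" "card P = p ^ multiplicity p ?n"
      using sylow_thm[OF p is_group m(1) fin] by blast
    with sylow_normal[OF fin max p m] show ?thesis by blast
  qed
  have "?n \<noteq> 1" using assms(2) order_one_triv_iff by blast
  then obtain p where p: "Factorial_Ring.prime p" "p dvd ?n" using prime_factor_nat by blast
  obtain P where P: "P \<lhd> G" "card P = p ^ multiplicity p ?n" using ex[OF p(1)] by blast
  interpret P: normal P G by fact
  interpret P': group "G\<lparr>carrier := P\<rparr>" by (rule P.subgroup_is_group[OF is_group])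
  have "multiplicity p ?n > 0" using p pos by (simp add: prime_multiplicity_gt_zero_iff)
  then obtain z where z: "z \<in> P" "z \<noteq> \<one>" "\<And>g. g \<in> P \<Longrightarrow> z \<otimes> g = g \<otimes> z"
    using P'.p_group_center_nontrivial[OF p(1), of "multiplicity p ?n"] P(2) by (auto simp: order_def)
  have zc: "z \<in> carrier G" using z by simp
  let ?C = "{y \<in> carrier G. y \<otimes> z = z \<otimes> y}"
  have C: "subgroup ?C G" by (rule subgroup_commuting[OF zc])
  have dvd: "q ^ multiplicity q ?n dvd card ?C" if q: "Factorial_Ring.prime q" for q :: nat
  proof -
    \<comment> \<open>For \<open>q = p\<close> the subgroup \<open>P\<close> itself is taken, since
      \<open>z\<close> is known to be central there.\<close>
    obtain Q where Q: "Q \<lhd> G" "card Q = q ^ multiplicity q ?n" "q = p \<Longrightarrow> Q = P"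
      using ex[OF q] P by metis
    interpret Q: normal Q G by fact
    have "z \<otimes> y = y \<otimes> z" if "y \<in> Q" for y
    proof (cases "q = p")
      case True
      then show ?thesis using Q(3) z(3) that by simp
    next
      case False
      interpret I: subgroup "P \<inter> Q" G by (rule subgroups_Inter_pair[OF P.subgroup_axioms Q.subgroup_axioms])
      have "card (P \<inter> Q) dvd card P" "card (P \<inter> Q) dvd card Q"
        using card_subgroup_dvd[OF I.subgroup_axioms P.subgroup_axioms]
          card_subgroup_dvd[OF I.subgroup_axioms Q.subgroup_axioms] by auto
      moreover have "coprime (card P) (card Q)"
        using P(2) Q(2) primes_coprime[OF p(1) q] False by simp
      ultimately have "card (P \<inter> Q) = 1" by (metis coprime_common_divisor_nat)
      then have "P \<inter> Q = {\<one>}" using I.one_closed by (metis card_1_singletonE singletonD)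
      then show ?thesis using normal_disjoint_commute[OF P(1) Q(1) _ z(1) that] by blast
    qed
    then have "Q \<subseteq> ?C" using Q.subset by auto
    show ?thesis using card_subgroup_dvd[OF Q.subgroup_axioms C \<open>Q \<subseteq> ?C\<close>] Q(2) by simp
  qed
  have finC: "finite ?C" using fin by simp
  have cC: "card ?C \<noteq> 0"
    unfolding card_0_eq[OF finC] using subgroup.one_closed[OF C] by (rule ex_in_conv[THEN iffD1, OF exI])
  \<comment> \<open>Comparing multiplicities prime by prime replaces a decomposition of the group as
    a product of its Sylow subgroups.\<close>
  have "?n dvd card ?C"
  proof (intro multiplicity_le_imp_dvd)
    fix q :: nat assume "Factorial_Ring.prime q"
    then show "multiplicity q ?n \<le> multiplicity q (card ?C)"
      using dvd not_prime_unit by (intro multiplicity_geI[OF cC]) auto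
  qed (use pos in simp)
  then have "card (carrier G) \<le> card ?C" unfolding order_def using cC by (intro dvd_imp_le) simp_all
  then have "?C = carrier G" using fin by (intro card_seteq) auto
  then have "z \<otimes> g = g \<otimes> z" if "g \<in> carrier G" for g using that by (metis (mono_tags, lifting) mem_Collect_eq)
  from that[OF zc z(2) this] show ?thesis .
qed

text \<open>One direction of the correspondence theorem, used to pass normality of all maximal
  subgroups to quotients.\<close>

lemma (in group_hom) maximal_subgroup_vimage:
  assumes "h ` carrier G = carrier H" "maximal_subgroup H M"
  shows "maximal_subgroup G {x \<in> carrier G. h x \<in> M}"
proof -
  interpret M: subgroup M H using assms(2) by (simp add: maximal_subgroup_def)
  let ?V = "{x \<in> carrier G. h x \<in> M}"
  have img: "h ` ?V = M"
  proof
    show "M \<subseteq> h ` ?V"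
    proof
      fix y assume y: "y \<in> M"
      then have "y \<in> h ` carrier G" unfolding assms(1) by (rule M.mem_carrier)
      then show "y \<in> h ` ?V" using y by blast
    qed
  qed blast
  show ?thesis unfolding maximal_subgroup_def
  proof (intro conjI allI impI)
    show "subgroup ?V G" by (rule G.subgroupI) (auto intro!: exI[of _ "\<one>"])
    show "?V \<noteq> carrier G" using img assms by (auto simp: maximal_subgroup_def)
    fix K assume K: "subgroup K G" "?V \<subseteq> K"
    interpret K: subgroup K G by fact
    have "subgroup (h ` K) H" by (rule subgroup_img_is_subgroup[OF K(1)])
    moreover have "M \<subseteq> h ` K" using image_mono[OF K(2), of h] img by simp
    ultimately consider "h ` K = M" | "h ` K = carrier H"
      using assms(2) unfolding maximal_subgroup_def by blast
    then show "K = ?V \<or> K = carrier G"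
    proof cases
      case 1
      then have "K \<subseteq> ?V" using K.subset by blast
      with K(2) show ?thesis by blast
    next
      case 2
      have "x \<in> K" if x: "x \<in> carrier G" for x
      proof -
        have "h x \<in> h ` K" using 2 x by simp
        then obtain k where k: "k \<in> K" "h x = h k" by blast
        then have "x \<otimes> inv k \<in> ?V" using x by simp
        then have "x \<otimes> inv k \<otimes> k \<in> K" using K(2) k(1) by blast
        then show ?thesis using x k(1) by (simp add: G.m_assoc)
      qed
      then show ?thesis using K.subset by blast
    qed
  qed
qed

text \<open>The premise \<open>ex\<close> says that every nontrivial quotient has a nontrivial
  center. Induction on the distance from \<open>N\<close> to the whole group replaces
  \<open>N\<close> by the preimage \<open>Z\<close> of the center of \<open>G Mod N\<close>: a term
  of the lower central series inside \<open>Z\<close> is followed by one inside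
  \<open>N\<close>.\<close>

lemma (in group) lower_central_eventually_subset:
  assumes fin: "finite (carrier G)"
    and ex: "\<And>N. N \<lhd> G \<Longrightarrow> N \<noteq> carrier G \<Longrightarrow>
      \<exists>x\<in>carrier G - N. \<forall>y\<in>carrier G. x \<otimes> y \<otimes> inv x \<otimes> inv y \<in> N"
    and "N \<lhd> G"
  shows "\<exists>n. lower_central G n \<subseteq> N"
  using \<open>N \<lhd> G\<close>
proof (induction "card (carrier G) - card N" arbitrary: N rule: less_induct)
  case less
  interpret N: normal N G by fact
  show ?case
  proof (cases "N = carrier G")
    case True
    then show ?thesis by (metis lower_central.simps(1) subset_refl)
  next
    case False
    interpret q: group_hom G "G Mod N" "\<lambda>x. N #> x" by (rule N.group_hom_Mod)
    let ?C = "\<lambda>a. {y \<in> carrier G. (N #> y) \<otimes>\<^bsub>G Mod N\<^esub> (N #> a) = (N #> a) \<otimes>\<^bsub>G Mod N\<^esub> (N #> y)}"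
    define Z where "Z = (\<Inter>a\<in>carrier G. ?C a)"
    have Z: "x \<in> Z \<longleftrightarrow> x \<in> carrier G \<and> (\<forall>y\<in>carrier G. x \<otimes> y \<otimes> inv x \<otimes> inv y \<in> N)" for x
    proof -
      have "x \<in> Z \<longleftrightarrow> (\<forall>y\<in>carrier G. x \<in> ?C y)" unfolding Z_def by (rule INT_iff)
      also have "\<dots> \<longleftrightarrow> x \<in> carrier G \<and> (\<forall>y\<in>carrier G. x \<in> ?C y)" using one_closed by blast
      finally show ?thesis using N.commutator_mem_iff by (simp del: mult_FactGroup cong: conj_cong)
    qed
    have Zs: "subgroup Z G"
      unfolding Z_def
    proof (rule subgroups_Inter)
      fix H assume "H \<in> ?C ` carrier G"
      then show "subgroup H G" using q.subgroup_commuting_image q.hom_closed by blast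
    qed auto
    have NZ: "N \<subseteq> Z"
    proof
      fix x assume x: "x \<in> N"
      have "x \<otimes> (y \<otimes> inv x \<otimes> inv y) \<in> N" if "y \<in> carrier G" for y
        using N.inv_op_closed2[OF that, of "inv x"] x by blast
      then show "x \<in> Z" unfolding Z using x by (simp add: m_assoc)
    qed
    have Zn: "Z \<lhd> G" unfolding normal_inv_iff
    proof (intro conjI ballI Zs)
      fix g x assume g: "g \<in> carrier G" and x: "x \<in> Z"
      then have xc: "x \<in> carrier G" and "x \<otimes> g \<otimes> inv x \<otimes> inv g \<in> N"
        unfolding Z by auto
      \<comment> \<open>Multiplying the inverse commutator by \<open>x\<close> gives the conjugate
        of \<open>x\<close> by \<open>g\<close>.\<close>
      then have "inv (x \<otimes> g \<otimes> inv x \<otimes> inv g) \<in> Z" using NZ N.m_inv_closed by blast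
      then have "inv (x \<otimes> g \<otimes> inv x \<otimes> inv g) \<otimes> x \<in> Z" using x subgroup.m_closed[OF Zs] by blast
      then show "g \<otimes> x \<otimes> inv g \<in> Z" using g xc by (simp add: m_assoc inv_mult_group inv_cancel_left)
    qed
    obtain z where z: "z \<in> Z" "z \<notin> N" using ex[OF less.prems False] Z by blast
    have fZ: "finite Z" by (rule finite_subset[OF subgroup.subset[OF Zs] fin])
    have "card N < card Z" by (rule psubset_card_mono[OF fZ]) (use NZ z in blast)
    moreover have "card Z \<le> card (carrier G)" by (rule card_mono[OF fin subgroup.subset[OF Zs]])
    ultimately have "card (carrier G) - card Z < card (carrier G) - card N" by linarith
    from less.hyps[OF this Zn] obtain n where n: "lower_central G n \<subseteq> Z" by blast
    have "lower_central G (Suc n) \<subseteq> N"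
      unfolding lower_central.simps commutator_def
    proof (rule generate_subgroup_incl[OF _ N.subgroup_axioms], clarify)
      fix h k assume "h \<in> lower_central G n" and k: "k \<in> carrier G"
      then have "h \<in> Z" using n by blast
      then show "h \<otimes> k \<otimes> inv h \<otimes> inv k \<in> N" using Z[of h] k by simp
    qed
    then show ?thesis by blast
  qed
qed

lemma (in group) nilpotent_if_maximal_normal:
  assumes fin: "finite (carrier G)" and max: "\<And>M. maximal_subgroup G M \<Longrightarrow> M \<lhd> G"
  shows "nilpotent_group G"
proof -
  have "\<exists>x\<in>carrier G - N. \<forall>y\<in>carrier G. x \<otimes> y \<otimes> inv x \<otimes> inv y \<in> N"
    if N: "N \<lhd> G" "N \<noteq> carrier G" for N
  proof -
    interpret N: normal N G by fact
    interpret q: group_hom G "G Mod N" "\<lambda>x. N #> x" by (rule N.group_hom_Mod)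
    have car: "carrier (G Mod N) = (\<lambda>x. N #> x) ` carrier G" by (rule carrier_FactGroup)
    obtain a where "a \<in> carrier G" "a \<notin> N" using N(2) N.subset by blast
    then have "N #> a \<in> carrier (G Mod N)" "N #> a \<noteq> \<one>\<^bsub>G Mod N\<^esub>"
      using N.r_coset_eq_iff car by auto
    then have "carrier (G Mod N) \<noteq> {\<one>\<^bsub>G Mod N\<^esub>}" by blast
    moreover have "finite (carrier (G Mod N))" using fin car by simp
    moreover have "M \<lhd> G Mod N" if M: "maximal_subgroup (G Mod N) M" for M
    proof -
      have "M \<subseteq> carrier (G Mod N)"
        using M by (auto simp: maximal_subgroup_def dest: subgroup.subset)
      then have "(\<lambda>x. N #> x) ` {x \<in> carrier G. N #> x \<in> M} = M" unfolding car by blast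
      moreover have "{x \<in> carrier G. N #> x \<in> M} \<lhd> G"
        by (rule max[OF q.maximal_subgroup_vimage[OF car[symmetric] M]])
      ultimately show ?thesis
        using normal.surj_hom_normal_subgroup[OF _ q.group_hom_axioms car[symmetric]] by metis
    qed
    ultimately obtain z where z: "z \<in> carrier (G Mod N)" "z \<noteq> \<one>\<^bsub>G Mod N\<^esub>"
      "\<And>g. g \<in> carrier (G Mod N) \<Longrightarrow> z \<otimes>\<^bsub>G Mod N\<^esub> g = g \<otimes>\<^bsub>G Mod N\<^esub> z"
      using q.H.center_nontrivial by blast
    then obtain x where x: "x \<in> carrier G" "z = N #> x" using car by blast
    have "x \<notin> N" using z(2) x N.r_coset_eq_iff by auto
    moreover have "x \<otimes> y \<otimes> inv x \<otimes> inv y \<in> N" if "y \<in> carrier G" for y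
      using N.commutator_mem_iff[OF x(1) that] z(3)[of "N #> y"] x(2) that car by blast
    ultimately show ?thesis using x(1) by blast
  qed
  from lower_central_eventually_subset[OF fin this one_is_normal]
  obtain n where "lower_central G n \<subseteq> {\<one>}" by blast
  then have "lower_central G n = {\<one>}" using subgroup.one_closed[OF lower_central_subgroup] by blast
  then show ?thesis unfolding nilpotent_group_def using is_group by blast
qed

text \<open>Let \<open>k\<close> be the first index whose lower central term lies in
  \<open>M\<close>. Some \<open>x\<close> in the preceding term is outside \<open>M\<close>, and its
  commutators with \<open>M\<close> lie in \<open>M\<close>, so \<open>x\<close> normalizes
  \<open>M\<close>. By maximality the normalizer is everything.\<close>

lemma (in group) nilpotent_maximal_normal:
  assumes fin: "finite (carrier G)" and "nilpotent_group G" and M: "maximal_subgroup G M"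
  shows "M \<lhd> G"
proof -
  interpret M: subgroup M G using M by (simp add: maximal_subgroup_def)
  let ?P = "\<lambda>n. lower_central G n \<subseteq> M"
  obtain n where "lower_central G n = {\<one>}" using assms(2) by (auto simp: nilpotent_group_def)
  then have "?P n" by simp
  define k where "k = (LEAST n. ?P n)"
  have k: "?P k" unfolding k_def by (rule LeastI) fact
  have "k \<noteq> 0"
  proof
    assume "k = 0"
    then show False using k M M.subset by (simp add: maximal_subgroup_def)
  qed
  then obtain j where j: "k = Suc j" by (cases k) auto
  have "\<not> ?P j" using not_less_Least[of j ?P] j k_def by simp
  then obtain x where x: "x \<in> lower_central G j" "x \<notin> M" by blast
  have xc: "x \<in> carrier G" using x(1) subgroup.subset[OF lower_central_subgroup] by blast
  let ?N = "{g \<in> carrier G. (\<lambda>h. g \<otimes> h \<otimes> inv g) ` M = M}"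
  \<comment> \<open>Finiteness upgrades the inclusion of the conjugate in \<open>M\<close> to an
    equality.\<close>
  have N: "g \<in> ?N" if g: "g \<in> carrier G" and sub: "\<And>h. h \<in> M \<Longrightarrow> g \<otimes> h \<otimes> inv g \<in> M" for g
  proof -
    have "inj_on (\<lambda>h. g \<otimes> h \<otimes> inv g) M" using g by (auto simp: inj_on_def)
    moreover have "finite M" using fin M.subset finite_subset by blast
    moreover have "(\<lambda>h. g \<otimes> h \<otimes> inv g) ` M \<subseteq> M" using sub by blast
    ultimately have "(\<lambda>h. g \<otimes> h \<otimes> inv g) ` M = M" by (simp add: endo_inj_surj)
    with g show ?thesis by blast
  qed
  have "M \<subseteq> ?N" using N M.mem_carrier by blast
  moreover have "x \<in> ?N"
  proof (rule N[OF xc])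
    fix h assume h: "h \<in> M"
    have "x \<otimes> h \<otimes> inv x \<otimes> inv h \<in> M"
      using lower_central_Suc_memI[OF x(1) M.mem_carrier[OF h]] k j by blast
    then have "x \<otimes> h \<otimes> inv x \<otimes> inv h \<otimes> h \<in> M" using h by blast
    then show "x \<otimes> h \<otimes> inv x \<in> M" using xc h by (simp add: m_assoc)
  qed
  ultimately have "?N = carrier G"
    using M x(2) subgroup_conj_fixing[OF M.subset] unfolding maximal_subgroup_def by blast
  then show ?thesis unfolding normal_inv_iff using M.subgroup_axioms by blast
qed

lemma (in group) nilpotent_iff_maximal_F_tilde_subnormal:
  assumes fin: "finite (carrier G)"
  shows "nilpotent_group G \<longleftrightarrow> (\<forall>M. maximal_subgroup G M \<longrightarrow> R_subnormal G (F_tilde G) M)"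
proof
  assume "nilpotent_group G"
  then show "\<forall>M. maximal_subgroup G M \<longrightarrow> R_subnormal G (F_tilde G) M"
    using nilpotent_maximal_normal[OF fin] R_subnormal_maximal_iff[OF _ F_tilde_subset] by blast
next
  assume R: "\<forall>M. maximal_subgroup G M \<longrightarrow> R_subnormal G (F_tilde G) M"
  show "nilpotent_group G"
  proof (rule nilpotent_if_maximal_normal[OF fin])
    fix M assume M: "maximal_subgroup G M"
    have "derived G (carrier G) \<subseteq> frattini G" using derived_subset_frattini[OF fin] R by blast
    also have "\<dots> \<subseteq> M" using M by (auto simp: frattini_def)
    finally show "M \<lhd> G" using normal_if_derived_subset M by (auto simp: maximal_subgroup_def)
  qed
qed

section \<open>The generalized Fitting subgroup of a Frattini cover\<close>

lemma (in group) center_normal: "center G \<lhd> G"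
proof -
  have eq: "center G = (\<Inter>a\<in>carrier G. {y \<in> carrier G. y \<otimes> a = a \<otimes> y})"
    by (rule Set.set_eqI) (use one_closed in \<open>auto simp: center_def\<close>)
  have sub: "subgroup (center G) G" unfolding eq
  proof (rule subgroups_Inter)
    fix H assume "H \<in> (\<lambda>a. {y \<in> carrier G. y \<otimes> a = a \<otimes> y}) ` carrier G"
    then show "subgroup H G" using subgroup_commuting by blast
  qed auto
  show ?thesis unfolding normal_inv_iff
  proof (intro conjI ballI sub)
    fix x h assume x: "x \<in> carrier G" and h: "h \<in> center G"
    then have hc: "h \<in> carrier G" and xh: "x \<otimes> h = h \<otimes> x" unfolding center_def by simp_all
    have "x \<otimes> h \<otimes> inv x = h" unfolding xh using x hc by (simp add: m_assoc)
    with h show "x \<otimes> h \<otimes> inv x \<in> center G" by simp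
  qed
qed

text \<open>Modulo the center, an abelian normal subgroup is trivial or everything; in the second case
  every element is a product of a central element and an element of the subgroup.\<close>

lemma (in group) quasisimple_abelian_normal_subset_center:
  assumes "quasisimple G" "A \<lhd> G" and comm: "\<And>a b. a \<in> A \<Longrightarrow> b \<in> A \<Longrightarrow> a \<otimes> b = b \<otimes> a"
  shows "A \<subseteq> center G"
proof -
  interpret A: normal A G by fact
  interpret Z: normal "center G" G by (rule center_normal)
  interpret q: group_hom G "G Mod center G" "\<lambda>x. center G #> x" by (rule Z.group_hom_Mod)
  have car: "carrier (G Mod center G) = (\<lambda>x. center G #> x) ` carrier G" by (rule carrier_FactGroup)
  interpret S: simple_group "G Mod center G" using assms(1) by (simp add: quasisimple_def)
  have "(\<lambda>x. center G #> x) ` A \<lhd> G Mod center G"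
    by (rule A.surj_hom_normal_subgroup[OF q.group_hom_axioms car[symmetric]])
  then have "(\<lambda>x. center G #> x) ` A = (\<lambda>x. center G #> x) ` carrier G \<or> (\<lambda>x. center G #> x) ` A = {center G}"
    using S.no_real_normal_subgroup car by simp
  then show ?thesis
  proof
    assume 1: "(\<lambda>x. center G #> x) ` A = (\<lambda>x. center G #> x) ` carrier G"
    have "a \<otimes> x = x \<otimes> a" if a: "a \<in> A" and x: "x \<in> carrier G" for a x
    proof -
      have "center G #> x \<in> (\<lambda>x. center G #> x) ` A" unfolding 1 using x by (rule imageI)
      then obtain b where b: "b \<in> A" "center G #> x = center G #> b" by blast
      then obtain z where z: "z \<in> center G" "x = z \<otimes> b"
        using rcos_self[OF x Z.subgroup_axioms] by (auto simp: r_coset_def)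
      have za: "z \<otimes> a = a \<otimes> z" using z(1) A.mem_carrier[OF a] unfolding center_def by blast
      have "a \<otimes> x = z \<otimes> a \<otimes> b" unfolding za z(2) using z(1) a b(1) by (simp add: m_assoc)
      also have "\<dots> = x \<otimes> a" unfolding z(2) using z(1) a b(1) by (simp add: m_assoc comm[OF a b(1)])
      finally show ?thesis .
    qed
    then show ?thesis using A.subset unfolding center_def by blast
  next
    assume "(\<lambda>x. center G #> x) ` A = {center G}"
    then have "center G #> a = center G" if "a \<in> A" for a using imageI[OF that, of "\<lambda>x. center G #> x"] by simp
    then have "a \<in> center G" if "a \<in> A" for a using that Z.r_coset_eq_iff[of a] by simp
    then show ?thesis by (rule subsetI)
  qed
qed

lemma (in group) quasisimple_not_abelian:
  assumes "quasisimple G"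
  shows "\<exists>x\<in>carrier G. \<exists>y\<in>carrier G. x \<otimes> y \<noteq> y \<otimes> x"
proof (rule ccontr)
  assume "\<not> ?thesis"
  then have "center G = carrier G" by (auto simp: center_def)
  moreover have "carrier G #> x = carrier G" if "x \<in> carrier G" for x
    by (rule coset_join2[OF that subgroup_self that])
  ultimately have "carrier (G Mod center G) = {carrier G}"
    unfolding carrier_FactGroup using one_closed by auto
  moreover have "simple_group (G Mod center G)" using assms by (simp add: quasisimple_def)
  ultimately show False using simple_group.order_gt_one by (fastforce simp: order_def)
qed

text \<open>If \<open>L\<close> centralizes all \<open>l k l\<^sup>-\<^sup>1 k\<^sup>-\<^sup>1\<close> for a fixed \<open>k\<close>, then \<open>l \<mapsto> l k l\<^sup>-\<^sup>1 k\<^sup>-\<^sup>1\<close> is a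
  homomorphism from \<open>L\<close> to an abelian group; so the perfect group \<open>L\<close> lies in its kernel.\<close>

lemma (in group) perfect_commutes_step:
  assumes L: "subgroup L G" "derived G L = L" and k: "k \<in> carrier G"
    and A: "A \<subseteq> carrier G" "\<And>a b. a \<in> A \<Longrightarrow> b \<in> A \<Longrightarrow> a \<otimes> b = b \<otimes> a"
      "\<And>a l. a \<in> A \<Longrightarrow> l \<in> L \<Longrightarrow> a \<otimes> l = l \<otimes> a"
    and f: "\<And>l. l \<in> L \<Longrightarrow> l \<otimes> k \<otimes> inv l \<otimes> inv k \<in> A"
    and l: "l \<in> L"
  shows "l \<otimes> k = k \<otimes> l"
proof -
  interpret L: subgroup L G by fact
  let ?f = "\<lambda>l. l \<otimes> k \<otimes> inv l \<otimes> inv k"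
  have fc: "?f x \<in> carrier G" if "x \<in> L" for x using f[OF that] A(1) by blast
  have f_mult: "?f (x \<otimes> y) = ?f x \<otimes> ?f y" if xy: "x \<in> L" "y \<in> L" for x y
  proof -
    have "?f (x \<otimes> y) = x \<otimes> ?f y \<otimes> (k \<otimes> inv x \<otimes> inv k)"
      using xy k by (simp add: m_assoc inv_mult_group inv_cancel_left)
    also have "\<dots> = ?f y \<otimes> ?f x"
      unfolding A(3)[OF f[OF xy(2)] xy(1), symmetric] using xy k fc by (simp add: m_assoc)
    also have "\<dots> = ?f x \<otimes> ?f y" by (rule A(2)[OF f f]) (use xy in auto)
    finally show ?thesis .
  qed
  let ?C = "{y \<in> carrier G. y \<otimes> k = k \<otimes> y}"
  have "derived_set G L \<subseteq> ?C"
  proof (intro UN_least)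
    fix x y assume xy: "x \<in> L" "y \<in> L"
    \<comment> \<open>Write \<open>x \<otimes> y\<close> as \<open>?c\<close> times
      \<open>y \<otimes> x\<close>. As the values of \<open>?f\<close> commute, \<open>?f\<close>
      agrees on \<open>x \<otimes> y\<close> and \<open>y \<otimes> x\<close>, which forces
      \<open>?f ?c\<close> to be trivial.\<close>
    let ?c = "x \<otimes> y \<otimes> inv x \<otimes> inv y"
    have xyc: "x \<in> carrier G" "y \<in> carrier G" using xy by auto
    then have "?c \<otimes> (y \<otimes> x) = x \<otimes> y" by (simp add: m_assoc inv_cancel_left)
    then have "?f ?c \<otimes> ?f (y \<otimes> x) = ?f (x \<otimes> y)" using f_mult[of ?c "y \<otimes> x"] xy by simp
    also have "\<dots> = ?f (y \<otimes> x)"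
      unfolding f_mult[OF xy] f_mult[OF xy(2) xy(1)] by (rule A(2)[OF f f]) (use xy in auto)
    finally have eq: "?f ?c \<otimes> ?f (y \<otimes> x) = ?f (y \<otimes> x)" .
    have "?f ?c \<in> carrier G" "?f (y \<otimes> x) \<in> carrier G" by (rule fc, use xy in simp)+
    then have "?f ?c = \<one>" using eq r_cancel_one[of "?f (y \<otimes> x)" "?f ?c"] by blast
    then have "?c \<otimes> k = k \<otimes> ?c"
      using commutator_eq_one_iff[of ?c k] xy k by simp
    then show "{?c} \<subseteq> ?C" using xy by simp
  qed
  then have "derived G L \<subseteq> ?C"
    unfolding derived_def by (rule generate_subgroup_incl[OF _ subgroup_commuting[OF k]])
  then show ?thesis using L(2) l by blast
qed

text \<open>Induction up the subnormal chain. At the bottom, \<open>K \<inter> L\<close> is abelian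
  and normal in \<open>L\<close>, hence central. When \<open>U\<close> is normal in
  \<open>V\<close>, commutators of \<open>L\<close> with an element of \<open>K \<inter> V\<close>
  fall into \<open>K \<inter> U\<close>, which is abelian and already centralized by
  \<open>L\<close>, so perfectness of \<open>L\<close> finishes the step.\<close>

lemma (in group) component_centralizes_abelian_normal:
  assumes "subnormal_in G L U" "quasisimple (G\<lparr>carrier := L\<rparr>)"
    and K: "K \<lhd> G" and comm: "\<And>a b. a \<in> K \<Longrightarrow> b \<in> K \<Longrightarrow> a \<otimes> b = b \<otimes> a"
  shows "\<forall>k\<in>K \<inter> U. \<forall>l\<in>L. k \<otimes> l = l \<otimes> k"
  using assms(1,2)
proof (induction rule: subnormal_in.induct)
  case (refl L)
  interpret K: normal K G by fact
  interpret L: subgroup L G by fact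
  interpret L': group "G\<lparr>carrier := L\<rparr>" by (rule L.subgroup_is_group[OF is_group])
  have "K \<inter> L \<lhd> G\<lparr>carrier := L\<rparr>" by (rule normal_Int_subgroup[OF refl(1) K])
  then have "K \<inter> L \<subseteq> center (G\<lparr>carrier := L\<rparr>)"
    by (rule L'.quasisimple_abelian_normal_subset_center[OF refl(2)]) (simp add: comm)
  then show ?case by (auto simp: center_def)
next
  case (step L U V)
  interpret K: normal K G by fact
  interpret U: normal U "G\<lparr>carrier := V\<rparr>" by fact
  interpret V: subgroup V G by fact
  have L: "subgroup L G" "subgroup U G" "L \<subseteq> U" using subnormal_in_subgroup[OF step(1)] by auto
  interpret L: subgroup L G by fact
  interpret U': subgroup U G by fact
  have UV: "U \<subseteq> V" using U.subset by simp
  have "derived G L = L"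
    using step.prems derived_consistent[OF order_refl L(1)] by (simp add: quasisimple_def)
  show ?case
  proof (intro ballI)
    fix k l assume k: "k \<in> K \<inter> V" and l: "l \<in> L"
    have "l \<otimes> k = k \<otimes> l"
    proof (rule perfect_commutes_step[OF L(1) \<open>derived G L = L\<close>, of k "K \<inter> U"])
      fix x assume x: "x \<in> L"
      then have xU: "inv x \<in> U" "x \<in> U" using L(3) by auto
      have "x \<otimes> k \<otimes> inv x \<in> K" using K.inv_op_closed2[of x k] k x by simp
      then have 1: "x \<otimes> k \<otimes> inv x \<otimes> inv k \<in> K" using k by blast
      have "k \<otimes> inv x \<otimes> inv k \<in> U"
        using U.inv_op_closed2[of k "inv x"] k xU V.subgroup_axioms by simp
      then have "x \<otimes> (k \<otimes> inv x \<otimes> inv k) \<in> U" using xU by blast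
      with 1 show "x \<otimes> k \<otimes> inv x \<otimes> inv k \<in> K \<inter> U" using x k by (simp add: m_assoc)
    qed (use step k l comm in auto)
    then show "k \<otimes> l = l \<otimes> k" by simp
  qed
qed

text \<open>Since \<open>t\<close> inverts \<open>g\<close> and \<open>g\<close> has cube 1, taking
  the commutator with \<open>t\<close> exchanges \<open>g\<close> and its inverse. So every term of
  the lower central series of \<open>N\<close> has \<open>g\<close> or its inverse in its image,
  also the trivial term.\<close>

lemma (in group_hom) nilpotent_normal_image_real_element:
  assumes N: "subgroup N G" "nilpotent_group (G\<lparr>carrier := N\<rparr>)"
    and gt: "g \<in> h ` N" "t \<in> h ` N" "t \<otimes>\<^bsub>H\<^esub> g \<otimes>\<^bsub>H\<^esub> inv\<^bsub>H\<^esub> t = inv\<^bsub>H\<^esub> g"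
    and g3: "g \<otimes>\<^bsub>H\<^esub> g \<otimes>\<^bsub>H\<^esub> g = \<one>\<^bsub>H\<^esub>"
  shows "g = \<one>\<^bsub>H\<^esub>"
proof -
  interpret N: subgroup N G by fact
  interpret N': group "G\<lparr>carrier := N\<rparr>" by (rule N.subgroup_is_group[OF G.is_group])
  obtain y where y: "y \<in> N" "h y = t" using gt by blast
  have gc: "g \<in> carrier H" "t \<in> carrier H" using gt by auto
  have gg: "g \<otimes>\<^bsub>H\<^esub> g = inv\<^bsub>H\<^esub> g" using H.inv_equality[OF g3 gc(1)] gc by simp
  have inv_gg: "inv\<^bsub>H\<^esub> g \<otimes>\<^bsub>H\<^esub> inv\<^bsub>H\<^esub> g = g"
    using gg gc(1) by (metis H.inv_inv H.inv_mult_group)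
  have t1: "t \<otimes>\<^bsub>H\<^esub> inv\<^bsub>H\<^esub> g \<otimes>\<^bsub>H\<^esub> inv\<^bsub>H\<^esub> t = g"
  proof -
    have "inv\<^bsub>H\<^esub> (t \<otimes>\<^bsub>H\<^esub> g \<otimes>\<^bsub>H\<^esub> inv\<^bsub>H\<^esub> t) = t \<otimes>\<^bsub>H\<^esub> inv\<^bsub>H\<^esub> g \<otimes>\<^bsub>H\<^esub> inv\<^bsub>H\<^esub> t"
      using gc by (simp add: H.inv_mult_group H.m_assoc)
    then show ?thesis using gt(3) gc by simp
  qed
  have ex: "\<exists>x\<in>lower_central (G\<lparr>carrier := N\<rparr>) n. h x = g \<or> h x = inv\<^bsub>H\<^esub> g" for n
  proof (induction n)
    case 0
    then show ?case using gt(1) by auto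
  next
    case (Suc n)
    then obtain x where x: "x \<in> lower_central (G\<lparr>carrier := N\<rparr>) n" "h x = g \<or> h x = inv\<^bsub>H\<^esub> g" by blast
    have xN: "x \<in> N" using x(1) N'.lower_central_subgroup[THEN subgroup.subset, of n] by auto
    have "x \<otimes> y \<otimes> inv x \<otimes> inv y \<in> lower_central (G\<lparr>carrier := N\<rparr>) (Suc n)"
      using lower_central_Suc_memI[OF x(1), of y] y(1) xN N.subgroup_axioms by simp
    moreover have "h (x \<otimes> y \<otimes> inv x \<otimes> inv y) = g \<or> h (x \<otimes> y \<otimes> inv x \<otimes> inv y) = inv\<^bsub>H\<^esub> g"
    proof -
      have eq: "h (x \<otimes> y \<otimes> inv x \<otimes> inv y) = h x \<otimes>\<^bsub>H\<^esub> (t \<otimes>\<^bsub>H\<^esub> inv\<^bsub>H\<^esub> h x \<otimes>\<^bsub>H\<^esub> inv\<^bsub>H\<^esub> t)"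
        using xN y gc by (simp add: H.m_assoc)
      from x(2) show ?thesis
      proof
        assume "h x = g"
        then show ?thesis unfolding eq using t1 gg by simp
      next
        assume "h x = inv\<^bsub>H\<^esub> g"
        then show ?thesis unfolding eq using gt(3) inv_gg gc by simp
      qed
    qed
    ultimately show ?case by blast
  qed
  obtain n where "lower_central (G\<lparr>carrier := N\<rparr>) n = {\<one>}" using N(2) by (auto simp: nilpotent_group_def)
  with ex[of n] have "\<one>\<^bsub>H\<^esub> = g \<or> \<one>\<^bsub>H\<^esub> = inv\<^bsub>H\<^esub> g" by simp
  then show ?thesis using gc(1) by (metis H.inv_eq_1_iff)
qed

text \<open>A component would centralize the abelian group \<open>K\<close>, hence lie in
  \<open>K\<close> and be abelian. So there are no components, and only the Fitting subgroup
  contributes.\<close>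

lemma (in group) F_star_subset:
  assumes K: "K \<lhd> G" and comm: "\<And>a b. a \<in> K \<Longrightarrow> b \<in> K \<Longrightarrow> a \<otimes> b = b \<otimes> a"
    and centralizer: "\<And>x. x \<in> carrier G \<Longrightarrow> (\<And>k. k \<in> K \<Longrightarrow> x \<otimes> k = k \<otimes> x) \<Longrightarrow> x \<in> K"
    and nilp: "\<And>N. N \<lhd> G \<Longrightarrow> nilpotent_group (G\<lparr>carrier := N\<rparr>) \<Longrightarrow> N \<subseteq> K"
  shows "F_star G \<subseteq> K"
proof -
  interpret K: normal K G by fact
  have no_comp: "\<not> component G L" for L
  proof
    assume L: "component G L"
    then have sub: "subgroup L G" using subnormal_in_subgroup unfolding component_def by blast
    interpret L: subgroup L G by fact
    interpret L': group "G\<lparr>carrier := L\<rparr>" by (rule L.subgroup_is_group[OF is_group])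
    have q: "quasisimple (G\<lparr>carrier := L\<rparr>)" using L by (simp add: component_def)
    have com: "\<forall>k\<in>K \<inter> carrier G. \<forall>l\<in>L. k \<otimes> l = l \<otimes> k"
      using component_centralizes_abelian_normal[OF _ q K comm] L unfolding component_def by blast
    have "l \<in> K" if l: "l \<in> L" for l
    proof (rule centralizer)
      show "l \<otimes> k = k \<otimes> l" if k: "k \<in> K" for k
        using com k l K.mem_carrier[OF k] by (metis IntI)
    qed (use l in simp)
    then have "x \<otimes> y = y \<otimes> x" if "x \<in> L" "y \<in> L" for x y using comm that by blast
    then show False using L'.quasisimple_not_abelian[OF q] by auto
  qed
  have "layer G \<subseteq> K" unfolding layer_def
    by (rule generate_subgroup_incl[OF _ K.subgroup_axioms]) (use no_comp in blast)
  moreover have "fitting G \<subseteq> K" unfolding fitting_def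
    by (rule generate_subgroup_incl[OF _ K.subgroup_axioms]) (use nilp in blast)
  ultimately show ?thesis unfolding F_star_def
    by (intro generate_subgroup_incl[OF _ K.subgroup_axioms]) simp
qed

text \<open>The kernel \<open>K\<close> separates the two halves of the argument:
  \<open>F_star G\<close> lies in \<open>K\<close> by the conditions on \<open>g\<close>,
  \<open>t\<close> and their lifts, and \<open>K\<close> lies in every maximal subgroup by
  \<open>min\<close>. Thus \<open>R_subnormal\<close> holds in its void case.\<close>

lemma (in group_hom) frattini_cover_F_star:
  assumes fin: "finite (carrier G)" and surj: "h ` carrier G = carrier H"
    and min: "\<And>U. subgroup U G \<Longrightarrow> h ` U = carrier H \<Longrightarrow> U = carrier G"
    and gt: "g \<in> carrier H" "t \<in> carrier H" "g \<noteq> \<one>\<^bsub>H\<^esub>" "g \<otimes>\<^bsub>H\<^esub> g \<otimes>\<^bsub>H\<^esub> g = \<one>\<^bsub>H\<^esub>"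
      "t \<otimes>\<^bsub>H\<^esub> g \<otimes>\<^bsub>H\<^esub> inv\<^bsub>H\<^esub> t = inv\<^bsub>H\<^esub> g"
    and D: "\<And>D. D \<lhd> H \<Longrightarrow> D \<noteq> {\<one>\<^bsub>H\<^esub>} \<Longrightarrow> g \<in> D \<and> t \<in> D"
    and ker_comm: "\<And>a b. a \<in> kernel G H h \<Longrightarrow> b \<in> kernel G H h \<Longrightarrow> a \<otimes> b = b \<otimes> a"
    and ker3: "\<And>a. a \<in> kernel G H h \<Longrightarrow> a \<otimes> a \<otimes> a = \<one>"
    and lift: "\<And>x. x \<in> carrier G \<Longrightarrow> h x = g \<Longrightarrow> x \<otimes> x \<otimes> x \<noteq> \<one>"
    and M: "maximal_subgroup G M"
  shows "R_subnormal G (F_star G) M"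
proof -
  define K where "K = kernel G H h"
  have K_mem: "x \<in> K \<longleftrightarrow> x \<in> carrier G \<and> h x = \<one>\<^bsub>H\<^esub>" for x by (simp add: K_def kernel_def)
  have "K \<lhd> G" unfolding K_def by (rule normal_kernel)
  then interpret K: normal K G .
  have img_normal: "h ` N \<lhd> H" if "N \<lhd> G" for N
    using normal.surj_hom_normal_subgroup[OF that group_hom_axioms surj] .
  have nontriv: "g \<in> h ` N \<and> t \<in> h ` N" if N: "N \<lhd> G" "\<not> N \<subseteq> K" for N
  proof (rule D[OF img_normal[OF N(1)]])
    obtain x where x: "x \<in> N" "x \<notin> K" using N(2) by blast
    moreover have "x \<in> carrier G" using x(1) N(1) by (meson normal_imp_subgroup subgroup.mem_carrier)
    ultimately have "h x \<in> h ` N" "h x \<noteq> \<one>\<^bsub>H\<^esub>" using K_mem by auto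
    then show "h ` N \<noteq> {\<one>\<^bsub>H\<^esub>}" by blast
  qed
  have "F_star G \<subseteq> K"
  proof (rule G.F_star_subset[OF K.normal_axioms])
    show "a \<otimes> b = b \<otimes> a" if "a \<in> K" "b \<in> K" for a b using ker_comm that by (simp add: K_def)
    show "N \<subseteq> K" if N: "N \<lhd> G" "nilpotent_group (G\<lparr>carrier := N\<rparr>)" for N
      using nontriv[OF N(1)] nilpotent_normal_image_real_element[OF normal_imp_subgroup[OF N(1)] N(2) _ _ gt(5,4)] gt(3)
      by blast
  next
    let ?C = "\<Inter>k\<in>K. {y \<in> carrier G. y \<otimes> k = k \<otimes> y}"
    have C: "x \<in> ?C \<longleftrightarrow> x \<in> carrier G \<and> (\<forall>k\<in>K. x \<otimes> k = k \<otimes> x)" for x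
      unfolding INT_iff using K.one_closed by blast
    have "subgroup ?C G"
    proof (rule G.subgroups_Inter)
      fix L assume "L \<in> (\<lambda>k. {y \<in> carrier G. y \<otimes> k = k \<otimes> y}) ` K"
      then show "subgroup L G" using G.subgroup_commuting K.mem_carrier by blast
    qed (use K.one_closed in blast)
    then have Cn: "?C \<lhd> G" unfolding G.normal_inv_iff
    proof (intro conjI ballI)
      fix x y assume x: "x \<in> carrier G" and y: "y \<in> ?C"
      have yc: "y \<in> carrier G" using y C by blast
      have "(x \<otimes> y \<otimes> inv x) \<otimes> k = k \<otimes> (x \<otimes> y \<otimes> inv x)" if k: "k \<in> K" for k
      proof -
        have kc: "k \<in> carrier G" using k by simp
        have "inv x \<otimes> k \<otimes> x \<in> K" using K.inv_op_closed1[OF x k] .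
        then have "y \<otimes> (inv x \<otimes> k \<otimes> x) = (inv x \<otimes> k \<otimes> x) \<otimes> y" using y C by blast
        then have "x \<otimes> (y \<otimes> (inv x \<otimes> k \<otimes> x)) \<otimes> inv x = x \<otimes> ((inv x \<otimes> k \<otimes> x) \<otimes> y) \<otimes> inv x" by simp
        then show ?thesis using x yc kc by (simp add: G.m_assoc G.inv_cancel_left)
      qed
      then show "x \<otimes> y \<otimes> inv x \<in> ?C" unfolding C using x yc by simp
    qed
    have "?C \<subseteq> K"
    proof (rule ccontr)
      assume "\<not> ?C \<subseteq> K"
      from nontriv[OF Cn this] have g: "g \<in> h ` ?C" and t: "t \<in> h ` ?C" by (rule conjunct1, rule conjunct2)
      from g obtain x where x: "x \<in> ?C" "h x = g" by (elim imageE) simp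
      from t obtain y where y: "y \<in> ?C" "h y = t" by (elim imageE) simp
      have xc: "x \<in> carrier G" and yc: "y \<in> carrier G" using x y C by blast+
      \<comment> \<open>The defect of \<open>y\<close> inverting \<open>x\<close>; it lies in
        \<open>K\<close> because \<open>t\<close> inverts \<open>g\<close>, so it commutes with
        \<open>x\<close> and \<open>y\<close>.\<close>
      define a where "a = x \<otimes> (y \<otimes> x \<otimes> inv y)"
      have "h a = g \<otimes>\<^bsub>H\<^esub> (t \<otimes>\<^bsub>H\<^esub> g \<otimes>\<^bsub>H\<^esub> inv\<^bsub>H\<^esub> t)"
        using x(2) y(2) xc yc by (simp add: a_def)
      then have "h a = \<one>\<^bsub>H\<^esub>" unfolding gt(5) using gt(1) by simp
      moreover have ac: "a \<in> carrier G" using xc yc by (simp add: a_def)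
      ultimately have aK: "a \<in> K" using K_mem[of a] by blast
      have xa: "x \<otimes> a = a \<otimes> x" and ya: "y \<otimes> a = a \<otimes> y" using x(1) y(1) aK C by blast+
      have yxy: "y \<otimes> x \<otimes> inv y = inv x \<otimes> a" using xc yc by (simp add: a_def G.inv_cancel_left)
      have yay: "y \<otimes> a \<otimes> inv y = a" unfolding ya using ac yc by (simp add: G.m_assoc)
      \<comment> \<open>The corrected lift of \<open>g\<close>: as \<open>a\<close> commutes with
        \<open>x\<close> and \<open>y\<close> and \<open>a \<otimes> a = inv a\<close>, the element
        \<open>y\<close> inverts \<open>z\<close> exactly.\<close>
      define z where "z = x \<otimes> a"
      have zc: "z \<in> carrier G" using xc ac by (simp add: z_def)
      have a3: "a \<otimes> a \<otimes> a = \<one>" using ker3 aK by (simp add: K_def)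
      then have inva: "inv a = a \<otimes> a" using G.inv_equality ac by simp
      have yzy: "y \<otimes> z \<otimes> inv y = inv z"
      proof -
        have "y \<otimes> z \<otimes> inv y = (y \<otimes> x \<otimes> inv y) \<otimes> (y \<otimes> a \<otimes> inv y)"
          using xc yc ac by (simp add: z_def G.m_assoc G.inv_cancel_left)
        also have "\<dots> = inv x \<otimes> inv a" unfolding yxy yay inva using xc ac by (simp add: G.m_assoc)
        also have "\<dots> = inv (a \<otimes> x)" using xc ac by (simp add: G.inv_mult_group)
        finally show ?thesis by (simp add: z_def xa)
      qed
      have hz: "h z = g" using x(2) aK xc K_mem gt(1) by (simp add: z_def)
      define w where "w = z \<otimes> z \<otimes> z"
      have wK: "w \<in> K" using K_mem zc hz gt(4) by (simp add: w_def)
      have wc: "w \<in> carrier G" using wK by simp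
      have "inv w = (y \<otimes> z \<otimes> inv y) \<otimes> (y \<otimes> z \<otimes> inv y) \<otimes> (y \<otimes> z \<otimes> inv y)"
        unfolding yzy w_def using zc by (simp add: G.inv_mult_group G.m_assoc)
      also have "\<dots> = y \<otimes> w \<otimes> inv y" using zc yc by (simp add: w_def G.m_assoc G.inv_cancel_left)
      also have "\<dots> = w"
      proof -
        have "y \<otimes> w = w \<otimes> y" using y(1) wK C by blast
        then show ?thesis using yc wc by (simp add: G.m_assoc)
      qed
      \<comment> \<open>\<open>y\<close> both inverts and centralizes \<open>w\<close>, so
        \<open>w\<close> has square 1; its cube is 1 as well.\<close>
      finally have "w \<otimes> w = \<one>" using wc by (metis G.r_inv)
      then have "w = \<one>" using ker3[of w] wK wc by (simp add: K_def)
      then show False using lift[OF zc hz] by (simp add: w_def)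
    qed
    then show "x \<in> K" if "x \<in> carrier G" "\<And>k. k \<in> K \<Longrightarrow> x \<otimes> k = k \<otimes> x" for x
      using that C by blast
  qed
  moreover have "K \<subseteq> M"
  proof (rule ccontr)
    assume nsub: "\<not> K \<subseteq> M"
    have Ms: "subgroup M G" using M by (simp add: maximal_subgroup_def)
    interpret hM: subgroup "h ` M" H by (rule subgroup_img_is_subgroup[OF Ms])
    \<comment> \<open>The full preimage of the image of \<open>M\<close>. It contains
      \<open>M\<close> and \<open>K\<close>, so it is everything; then \<open>M\<close> maps onto
      \<open>H\<close>, against \<open>min\<close>.\<close>
    let ?U = "{x \<in> carrier G. h x \<in> h ` M}"
    have "subgroup ?U G" by (rule G.subgroupI) (auto intro!: exI[of _ "\<one>"] simp del: image_iff)
    moreover have "M \<subseteq> ?U" using subgroup.subset[OF Ms] by auto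
    moreover have "?U \<noteq> M"
    proof
      have "K \<subseteq> ?U" using K_mem hM.one_closed by auto
      moreover assume "?U = M"
      ultimately show False using nsub by blast
    qed
    ultimately have "?U = carrier G" using M unfolding maximal_subgroup_def by blast
    then have "h ` carrier G \<subseteq> h ` M" by blast
    then have "h ` M = carrier H" using surj hM.subset by simp
    then have "M = carrier G" by (rule min[OF Ms])
    then show False using M by (simp add: maximal_subgroup_def)
  qed
  moreover have "K \<subseteq> carrier G" by (rule K.subset)
  ultimately show ?thesis using G.R_subnormal_maximal_iff[OF M, of "F_star G"] by blast
qed

section \<open>A cover all of whose normal subgroups contain a fixed real element of order 3\<close>

text \<open>A concrete copy of the wreath product of the symmetric group on five points by the regular
  representation of \<open>G\<close>: the permutations of \<open>G \<times> {0, \<dots>, 4}\<close> which induce a left translation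
  of \<open>G\<close>.\<close>

definition wreath5 :: "('a, 'b) monoid_scheme \<Rightarrow> ('a \<times> nat \<Rightarrow> 'a \<times> nat) monoid" where
  "wreath5 G = \<lparr>carrier = {\<pi>. \<pi> permutes carrier G \<times> {..<5} \<and>
      (\<exists>g\<in>carrier G. \<forall>x\<in>carrier G \<times> {..<5}. fst (\<pi> x) = g \<otimes>\<^bsub>G\<^esub> fst x)},
    monoid.mult = (\<circ>), one = id\<rparr>"

lemma wreath5_simps [simp]:
  "x \<otimes>\<^bsub>wreath5 G\<^esub> y = x \<circ> y" "\<one>\<^bsub>wreath5 G\<^esub> = id"
  by (simp_all add: wreath5_def)

lemma wreath5_carrier:
  "\<pi> \<in> carrier (wreath5 G) \<longleftrightarrow> \<pi> permutes carrier G \<times> {..<5} \<and>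
      (\<exists>g\<in>carrier G. \<forall>x\<in>carrier G \<times> {..<5}. fst (\<pi> x) = g \<otimes>\<^bsub>G\<^esub> fst x)"
  by (simp add: wreath5_def)

lemma (in group) wreath5_inv_closed:
  assumes "\<pi> \<in> carrier (wreath5 G)"
  shows "inv_into UNIV \<pi> \<in> carrier (wreath5 G)"
proof -
  from assms obtain g where \<pi>: "\<pi> permutes carrier G \<times> {..<5}" and g: "g \<in> carrier G"
    "\<And>x. x \<in> carrier G \<times> {..<5} \<Longrightarrow> fst (\<pi> x) = g \<otimes> fst x"
    unfolding wreath5_carrier by blast
  have "fst (inv_into UNIV \<pi> x) = inv g \<otimes> fst x" if x: "x \<in> carrier G \<times> {..<5}" for x
  proof -
    have y: "inv_into UNIV \<pi> x \<in> carrier G \<times> {..<5}"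
      using permutes_in_image[OF permutes_inv[OF \<pi>]] x by blast
    have "\<pi> (inv_into UNIV \<pi> x) = x" by (rule permutes_inverses(1)[OF \<pi>])
    then have "fst x = g \<otimes> fst (inv_into UNIV \<pi> x)" using g(2)[OF y] by simp
    moreover have "fst (inv_into UNIV \<pi> x) \<in> carrier G" using y by auto
    ultimately show ?thesis using g(1) by (simp add: inv_cancel_left)
  qed
  then show ?thesis unfolding wreath5_carrier using permutes_inv[OF \<pi>] g(1) inv_closed by blast
qed

lemma (in group) group_wreath5: "group (wreath5 G)"
proof (rule groupI)
  fix \<pi> \<rho> assume "\<pi> \<in> carrier (wreath5 G)" "\<rho> \<in> carrier (wreath5 G)"
  then obtain g h where \<pi>: "\<pi> permutes carrier G \<times> {..<5}" and g: "g \<in> carrier G"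
      "\<And>x. x \<in> carrier G \<times> {..<5} \<Longrightarrow> fst (\<pi> x) = g \<otimes> fst x"
    and \<rho>: "\<rho> permutes carrier G \<times> {..<5}" and h: "h \<in> carrier G"
      "\<And>x. x \<in> carrier G \<times> {..<5} \<Longrightarrow> fst (\<rho> x) = h \<otimes> fst x"
    unfolding wreath5_carrier by blast
  have "fst ((\<pi> \<circ> \<rho>) x) = g \<otimes> h \<otimes> fst x" if x: "x \<in> carrier G \<times> {..<5}" for x
  proof -
    have "\<rho> x \<in> carrier G \<times> {..<5}" using permutes_in_image[OF \<rho>] x by blast
    moreover have "fst x \<in> carrier G" using x by auto
    ultimately show ?thesis using g h x by (simp add: m_assoc)
  qed
  then show "\<pi> \<otimes>\<^bsub>wreath5 G\<^esub> \<rho> \<in> carrier (wreath5 G)"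
    unfolding wreath5_carrier wreath5_simps using permutes_compose[OF \<rho> \<pi>] g(1) h(1) m_closed by blast
next
  show "\<one>\<^bsub>wreath5 G\<^esub> \<in> carrier (wreath5 G)"
    unfolding wreath5_carrier by (auto intro!: bexI[of _ \<one>] permutes_id)
next
  fix \<pi> assume \<pi>: "\<pi> \<in> carrier (wreath5 G)"
  have "inv_into UNIV \<pi> \<circ> \<pi> = id" using \<pi> permutes_inv_o(2) unfolding wreath5_carrier by blast
  then show "\<exists>\<rho>\<in>carrier (wreath5 G). \<rho> \<otimes>\<^bsub>wreath5 G\<^esub> \<pi> = \<one>\<^bsub>wreath5 G\<^esub>"
    using wreath5_inv_closed[OF \<pi>] by auto
qed auto

lemma (in group) finite_wreath5: "finite (carrier G) \<Longrightarrow> finite (carrier (wreath5 G))"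
  by (rule finite_subset[of _ "{\<pi>. \<pi> permutes carrier G \<times> {..<5::nat}}"])
    (auto simp: wreath5_carrier finite_permutations)

lemma (in group) inv_wreath5:
  assumes "\<pi> \<in> carrier (wreath5 G)"
  shows "inv\<^bsub>wreath5 G\<^esub> \<pi> = inv_into UNIV \<pi>"
proof -
  interpret W: group "wreath5 G" by (rule group_wreath5)
  have "inv_into UNIV \<pi> \<circ> \<pi> = id" using assms permutes_inv_o(2) unfolding wreath5_carrier by blast
  then show ?thesis using W.inv_equality[OF _ assms wreath5_inv_closed[OF assms]] by simp
qed

text \<open>These lifts of the left translations give surjectivity onto \<open>G\<close> and later
  move 3-cycles from one fibre to another.\<close>

lemma (in group) translation_in_wreath5:
  assumes g: "g \<in> carrier G"
  defines "\<pi> \<equiv> \<lambda>x. if x \<in> carrier G \<times> {..<5::nat} then (g \<otimes> fst x, snd x) else x"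
  shows "\<pi> \<in> carrier (wreath5 G)"
proof -
  have "bij_betw \<pi> (carrier G \<times> {..<5}) (carrier G \<times> {..<5})"
    by (rule bij_betwI[of _ _ _ "\<lambda>x. (inv g \<otimes> fst x, snd x)"])
      (auto simp: \<pi>_def g inv_cancel_left)
  then have "\<pi> permutes carrier G \<times> {..<5}"
    by (rule bij_imp_permutes) (simp add: \<pi>_def)
  then show ?thesis unfolding wreath5_carrier using g by (auto simp: \<pi>_def)
qed

text \<open>The point over the identity reads off which translation a permutation induces.\<close>

lemma (in group) wreath5_hom:
  "(\<lambda>\<pi>. fst (\<pi> (\<one>, 0))) \<in> hom (wreath5 G) G"
  "(\<lambda>\<pi>. fst (\<pi> (\<one>, 0))) ` carrier (wreath5 G) = carrier G"
proof -
  let ?f = "\<lambda>\<pi> :: 'a \<times> nat \<Rightarrow> 'a \<times> nat. fst (\<pi> (\<one>, 0))"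
  have f: "?f \<pi> \<in> carrier G \<and> (\<forall>x\<in>carrier G \<times> {..<5}. fst (\<pi> x) = ?f \<pi> \<otimes> fst x)"
    if \<pi>: "\<pi> \<in> carrier (wreath5 G)" for \<pi>
  proof -
    obtain g where g: "g \<in> carrier G" "\<forall>x\<in>carrier G \<times> {..<5}. fst (\<pi> x) = g \<otimes> fst x"
      using wreath5_carrier[THEN iffD1, OF \<pi>] by (elim conjE bexE)
    moreover from this have "?f \<pi> = g" by simp
    ultimately show ?thesis by simp
  qed
  show "?f \<in> hom (wreath5 G) G"
  proof (rule homI)
    fix \<pi> \<rho> assume \<pi>: "\<pi> \<in> carrier (wreath5 G)" and \<rho>: "\<rho> \<in> carrier (wreath5 G)"
    have "\<rho> (\<one>, 0) \<in> carrier G \<times> {..<5}"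
      using \<rho> permutes_in_image[of \<rho> "carrier G \<times> {..<5}" "(\<one>, 0)"] unfolding wreath5_carrier by simp
    then have "fst (\<pi> (\<rho> (\<one>, 0))) = ?f \<pi> \<otimes> ?f \<rho>"
      by (rule bspec[OF conjunct2[OF f[OF \<pi>]]])
    then show "?f (\<pi> \<otimes>\<^bsub>wreath5 G\<^esub> \<rho>) = ?f \<pi> \<otimes> ?f \<rho>" by simp
  qed (rule conjunct1[OF f])
  show "?f ` carrier (wreath5 G) = carrier G"
  proof (intro subset_antisym subsetI)
    fix g assume "g \<in> carrier G"
    then show "g \<in> ?f ` carrier (wreath5 G)"
      by (intro image_eqI[OF _ translation_in_wreath5]) simp_all
  next
    fix g assume "g \<in> ?f ` carrier (wreath5 G)"
    then show "g \<in> carrier G" using f[THEN conjunct1] by (elim imageE) simp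
  qed
qed

text \<open>For distinct arguments this is the cycle a -> b -> c -> a, since the right factor acts
  first. A product of transpositions can be conjugated factor by factor.\<close>

abbreviation cycle3 :: "'a \<Rightarrow> 'a \<Rightarrow> 'a \<Rightarrow> 'a \<Rightarrow> 'a" where
  "cycle3 a b c \<equiv> transpose a b \<circ> transpose b c"

section \<open>Three-cycles in normal subgroups of the wreath product\<close>

lemma conj_transpose:
  assumes "bij \<pi>"
  shows "\<pi> \<circ> transpose a b \<circ> inv_into UNIV \<pi> = transpose (\<pi> a) (\<pi> b)"
proof -
  have "transpose (\<pi> a) (\<pi> b) \<circ> \<pi> = \<pi> \<circ> transpose a b"
    using transpose_comp_eq[OF assms, of "\<pi> a" "\<pi> b"] assms by (simp add: bij_is_inj)
  then have "\<pi> \<circ> transpose a b \<circ> inv_into UNIV \<pi> = transpose (\<pi> a) (\<pi> b) \<circ> (\<pi> \<circ> inv_into UNIV \<pi>)"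
    by (metis comp_assoc)
  also have "\<pi> \<circ> inv_into UNIV \<pi> = id" using assms by (metis bij_is_surj surj_iff)
  finally show ?thesis by (simp only: comp_id)
qed

lemma conj_transpose_comp:
  assumes "bij \<pi>"
  shows "\<pi> \<circ> (transpose a b \<circ> transpose c d) \<circ> inv_into UNIV \<pi> =
    transpose (\<pi> a) (\<pi> b) \<circ> transpose (\<pi> c) (\<pi> d)"
proof -
  have "\<pi> \<circ> (transpose a b \<circ> transpose c d) \<circ> inv_into UNIV \<pi> =
      (\<pi> \<circ> transpose a b \<circ> inv_into UNIV \<pi>) \<circ> (\<pi> \<circ> transpose c d \<circ> inv_into UNIV \<pi>)"
    using bij_is_inj[OF assms] by (simp add: fun_eq_iff)
  then show ?thesis by (simp only: conj_transpose[OF assms])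
qed

lemma (in group) transpose_in_wreath5:
  assumes "x \<in> carrier G \<times> {..<5}" "y \<in> carrier G \<times> {..<5}" "fst x = fst y"
  shows "transpose x y \<in> carrier (wreath5 G)"
  unfolding wreath5_carrier
proof (intro conjI bexI[of _ \<one>] ballI)
  show "transpose x y permutes carrier G \<times> {..<5}" by (rule permutes_swap_id) (use assms in auto)
  fix w assume "w \<in> carrier G \<times> {..<5::nat}"
  then have "fst w \<in> carrier G" by auto
  then show "fst (transpose x y w) = \<one> \<otimes> fst w" using assms(3) by (simp add: transpose_def)
qed simp

text \<open>One reason for fibres of five points: four forbidden points always leave a fifth. The
  forbidden points may coincide or lie over other elements.\<close>

lemma fibre_avoid:
  assumes "g \<in> carrier G"
  obtains e where "e \<in> carrier G \<times> {..<5::nat}" "fst e = g" "e \<noteq> a" "e \<noteq> b" "e \<noteq> c" "e \<noteq> d"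
proof -
  have "\<not> {..<5::nat} \<subseteq> set [snd a, snd b, snd c, snd d]"
  proof
    assume "{..<5::nat} \<subseteq> set [snd a, snd b, snd c, snd d]"
    then have "card {..<5::nat} \<le> card (set [snd a, snd b, snd c, snd d])" by (rule card_mono[rotated]) simp
    also have "\<dots> \<le> length [snd a, snd b, snd c, snd d]" by (rule card_length)
    finally show False by simp
  qed
  then obtain i where "i < 5" "i \<notin> {snd a, snd b, snd c, snd d}" by auto
  then show ?thesis using assms by (intro that[of "(g, i)"]) auto
qed

text \<open>The commutator of a nontrivial permutation with a transposition inside a fibre is a product of
  two different transpositions inside fibres; from this one manufactures a 3-cycle.\<close>

lemma (in group) normal_wreath5_ex_cycle3:
  assumes D: "D \<lhd> wreath5 G" "D \<noteq> {id}"
  obtains a b c where "{a, b, c} \<subseteq> carrier G \<times> {..<5}" "distinct [a, b, c]"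
    "fst a = fst b" "fst b = fst c" "cycle3 a b c \<in> D"
proof -
  let ?X = "carrier G \<times> {..<5::nat}"
  interpret D: normal D "wreath5 G" by fact
  have "id \<in> D" using subgroup.one_closed[OF D.subgroup_axioms] by simp
  then obtain \<sigma> where \<sigma>: "\<sigma> \<in> D" "\<sigma> \<noteq> id" using D(2) by blast
  have \<sigma>W: "\<sigma> \<in> carrier (wreath5 G)" using \<sigma>(1) by simp
  then obtain g where perm: "\<sigma> permutes ?X" and g: "g \<in> carrier G" "\<And>x. x \<in> ?X \<Longrightarrow> fst (\<sigma> x) = g \<otimes> fst x"
    unfolding wreath5_carrier by blast
  obtain x where x: "\<sigma> x \<noteq> x" using \<sigma>(2) by fastforce
  then have xX: "x \<in> ?X" using perm by (meson permutes_not_in)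
  then have fx: "fst x \<in> carrier G" by auto
  \<comment> \<open>Avoiding \<open>\<sigma> x\<close> ensures that \<open>?y\<close> differs from
    both points moved by \<open>?\<tau>\<close>.\<close>
  obtain z where z: "z \<in> ?X" "fst z = fst x" "z \<noteq> x" "z \<noteq> \<sigma> x"
    by (rule fibre_avoid[OF fx, of x "\<sigma> x" x x])
  let ?y = "\<sigma> x" and ?y' = "\<sigma> z" and ?\<tau> = "transpose x z"
  have yX: "?y \<in> ?X" "?y' \<in> ?X" using permutes_in_image[OF perm] xX z(1) by auto
  have fy: "fst ?y = fst ?y'" using g(2) xX z by simp
  have yy': "?y \<noteq> ?y'" using permutes_inj[OF perm] z(3) by (metis injD)
  have \<tau>W: "?\<tau> \<in> carrier (wreath5 G)" by (rule transpose_in_wreath5) (use xX z in auto)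
  have inv\<sigma>: "inv_into UNIV \<sigma> \<in> D" using D.m_inv_closed[OF \<sigma>(1)] inv_wreath5[OF \<sigma>W] by simp
  have "?\<tau> \<circ> inv_into UNIV \<sigma> \<circ> ?\<tau> \<in> D"
    using D.inv_op_closed2[OF \<tau>W inv\<sigma>] inv_wreath5[OF \<tau>W] by simp
  then have "\<sigma> \<circ> (?\<tau> \<circ> inv_into UNIV \<sigma> \<circ> ?\<tau>) \<in> D" using subgroup.m_closed[OF D.subgroup_axioms, OF \<sigma>(1)] by simp
  moreover have "\<sigma> \<circ> (?\<tau> \<circ> inv_into UNIV \<sigma> \<circ> ?\<tau>) = transpose ?y ?y' \<circ> ?\<tau>"
    using conj_transpose[OF permutes_bij[OF perm], of x z] by (simp add: comp_assoc[symmetric])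
  ultimately have c: "transpose ?y ?y' \<circ> ?\<tau> \<in> D" by simp
  \<comment> \<open>If \<open>?y'\<close> is \<open>x\<close> or \<open>z\<close>, the two
    transpositions share one point and their product is already a 3-cycle. Otherwise they are
    disjoint; replacing \<open>z\<close> by a new point \<open>e\<close> through conjugation and
    multiplying cancels \<open>transpose ?y ?y'\<close>.\<close>
  consider "?y' = x" | "?y' = z" | "?y' \<noteq> x" "?y' \<noteq> z" by blast
  then show ?thesis
  proof cases
    case 1
    show ?thesis by (rule that[of ?y x z]) (use 1 c xX z yX fy x in auto)
  next
    case 2
    show ?thesis by (rule that[of ?y z x]) (use 2 c xX z yX fy x in \<open>auto simp: transpose_commute\<close>)
  next
    case 3
    obtain e where e: "e \<in> ?X" "fst e = fst x" "e \<noteq> x" "e \<noteq> z" "e \<noteq> ?y" "e \<noteq> ?y'"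
      by (rule fibre_avoid[OF fx, of x z ?y ?y'])
    let ?\<kappa> = "transpose z e"
    have \<kappa>W: "?\<kappa> \<in> carrier (wreath5 G)" by (rule transpose_in_wreath5) (use e z in auto)
    have "?\<kappa> \<circ> (transpose ?y ?y' \<circ> ?\<tau>) \<circ> inv_into UNIV ?\<kappa> \<in> D"
      using D.inv_op_closed2[OF \<kappa>W c] inv_wreath5[OF \<kappa>W] by simp
    then have "transpose ?y ?y' \<circ> transpose x e \<in> D"
      unfolding conj_transpose_comp[OF bij_transpose] using 3 z(3,4) e x by simp
    then have "(transpose ?y ?y' \<circ> ?\<tau>) \<circ> (transpose ?y ?y' \<circ> transpose x e) \<in> D" using subgroup.m_closed[OF D.subgroup_axioms, OF c] by simp
    moreover have "(transpose ?y ?y' \<circ> ?\<tau>) \<circ> (transpose ?y ?y' \<circ> transpose x e) = cycle3 z x e"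
      using 3 z(3,4) e(3-6) x yy' by (auto simp: fun_eq_iff transpose_def)
    ultimately show ?thesis by (intro that[of z x e]) (use e xX z in auto)
  qed
qed

text \<open>All 3-cycles inside fibres are conjugate: a translation moves one into the fibre of
  \<open>x\<close>, and then transpositions put its points on \<open>x\<close>, \<open>y\<close> and
  \<open>z\<close> in turn, fixing the points already placed.\<close>

lemma (in group) normal_wreath5_cycle3:
  assumes D: "D \<lhd> wreath5 G" "D \<noteq> {id}"
    and x: "{x, y, z} \<subseteq> carrier G \<times> {..<5}" "distinct [x, y, z]" "fst x = fst y" "fst y = fst z"
  shows "cycle3 x y z \<in> D"
proof -
  let ?X = "carrier G \<times> {..<5::nat}"
  interpret D: normal D "wreath5 G" by fact
  define good where "good a b c \<longleftrightarrow> {a, b, c} \<subseteq> ?X \<and> distinct [a, b, c] \<and>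
    fst a = fst b \<and> fst b = fst c \<and> cycle3 a b c \<in> D" for a b c
  have good_conj: "good (\<pi> a) (\<pi> b) (\<pi> c)" if \<pi>: "\<pi> \<in> carrier (wreath5 G)" and "good a b c" for \<pi> a b c
  proof -
    obtain g where perm: "\<pi> permutes ?X" and g: "g \<in> carrier G" "\<And>x. x \<in> ?X \<Longrightarrow> fst (\<pi> x) = g \<otimes> fst x"
      using \<pi> unfolding wreath5_carrier by blast
    have ab: "a \<in> ?X" "b \<in> ?X" "c \<in> ?X" "a \<noteq> b" "a \<noteq> c" "b \<noteq> c" "fst a = fst b" "fst b = fst c" "cycle3 a b c \<in> D"
      using \<open>good a b c\<close> by (auto simp: good_def)
    have "\<pi> \<circ> cycle3 a b c \<circ> inv_into UNIV \<pi> \<in> D"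
      using D.inv_op_closed2[OF \<pi> ab(9)] inv_wreath5[OF \<pi>] by simp
    then have "cycle3 (\<pi> a) (\<pi> b) (\<pi> c) \<in> D" unfolding conj_transpose_comp[OF permutes_bij[OF perm]] .
    moreover have "\<pi> a \<in> ?X" "\<pi> b \<in> ?X" "\<pi> c \<in> ?X" using ab(1-3) permutes_in_image[OF perm] by blast+
    moreover have "\<pi> a \<noteq> \<pi> b" "\<pi> a \<noteq> \<pi> c" "\<pi> b \<noteq> \<pi> c" using ab(4-6) permutes_inj[OF perm] by (auto dest: injD)
    moreover have "fst (\<pi> a) = fst (\<pi> b)" "fst (\<pi> b) = fst (\<pi> c)" using g(2) ab(1-3,7,8) by simp_all
    ultimately show ?thesis unfolding good_def by simp
  qed
  have xX: "x \<in> ?X" "y \<in> ?X" "z \<in> ?X" and xyz: "x \<noteq> y" "x \<noteq> z" "y \<noteq> z" using x by auto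
  obtain a b c where abc: "good a b c"
    using normal_wreath5_ex_cycle3[OF D] unfolding good_def by metis
  then have aX: "a \<in> ?X" by (simp add: good_def)
  let ?g = "fst x \<otimes> inv (fst a)"
  have gc: "?g \<in> carrier G" "?g \<otimes> fst a = fst x" using aX xX by (auto simp: m_assoc)
  obtain a1 b1 c1 where 1: "good a1 b1 c1" "fst a1 = fst x"
    using good_conj[OF translation_in_wreath5[OF gc(1)] abc] aX gc(2) by fastforce
  have t1: "transpose a1 x \<in> carrier (wreath5 G)"
    by (rule transpose_in_wreath5) (use 1 xX in \<open>auto simp: good_def\<close>)
  obtain b2 c2 where 2: "good x b2 c2" using good_conj[OF t1 1(1)] by auto
  have t2: "transpose b2 y \<in> carrier (wreath5 G)"
    by (rule transpose_in_wreath5) (use 2 x(3) xX in \<open>auto simp: good_def\<close>)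
  have "transpose b2 y x = x" using 2 xyz by (auto simp: good_def transpose_def)
  then obtain c3 where 3: "good x y c3" using good_conj[OF t2 2] by auto
  have t3: "transpose c3 z \<in> carrier (wreath5 G)"
    by (rule transpose_in_wreath5) (use 3 x(3,4) xX in \<open>auto simp: good_def\<close>)
  have "transpose c3 z x = x" "transpose c3 z y = y" using 3 xyz by (auto simp: good_def transpose_def)
  then have "good x y z" using good_conj[OF t3 3] by simp
  then show ?thesis by (simp add: good_def)
qed

lemma (in group) exists_cover_with_real_order_3:
  assumes fin: "finite (carrier G)"
  obtains W :: "('a \<times> nat \<Rightarrow> 'a \<times> nat) monoid" and \<rho> g t where
    "group W" "finite (carrier W)" "\<rho> \<in> hom W G" "\<rho> ` carrier W = carrier G"
    "g \<in> carrier W" "t \<in> carrier W" "g \<noteq> \<one>\<^bsub>W\<^esub>" "g \<otimes>\<^bsub>W\<^esub> g \<otimes>\<^bsub>W\<^esub> g = \<one>\<^bsub>W\<^esub>"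
    "t \<otimes>\<^bsub>W\<^esub> g \<otimes>\<^bsub>W\<^esub> inv\<^bsub>W\<^esub> t = inv\<^bsub>W\<^esub> g"
    "\<And>D. D \<lhd> W \<Longrightarrow> D \<noteq> {\<one>\<^bsub>W\<^esub>} \<Longrightarrow> g \<in> D \<and> t \<in> D"
proof -
  let ?W = "wreath5 G"
  interpret W: group ?W by (rule group_wreath5)
  define p where "p i = (\<one>, i)" for i :: nat
  have p: "p i \<in> carrier G \<times> {..<5}" if "i < 5" for i using that by (simp add: p_def)
  have p_eq: "p i = p j \<longleftrightarrow> i = j" for i j by (simp add: p_def)
  let ?g = "cycle3 (p 0) (p 1) (p 2)"
  \<comment> \<open>The first transposition alone would invert \<open>?g\<close>. The second,
    disjoint from the support of \<open>?g\<close>, makes \<open>?t\<close> even and so a product of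
    3-cycles, as membership in every nontrivial normal subgroup requires.\<close>
  let ?t = "transpose (p 0) (p 1) \<circ> transpose (p 3) (p 4)"
  have tr: "transpose (p i) (p j) \<in> carrier ?W" if "i < 5" "j < 5" for i j
    by (rule transpose_in_wreath5) (use that in \<open>auto simp: p_def\<close>)
  have gW: "?g \<in> carrier ?W" using W.m_closed[OF tr[of 0 1] tr[of 1 2]] by simp
  have tW: "?t \<in> carrier ?W" using W.m_closed[OF tr[of 0 1] tr[of 3 4]] by simp
  have g3: "?g \<circ> ?g \<circ> ?g = id" by (auto simp: fun_eq_iff transpose_def p_eq)
  have ginv: "inv\<^bsub>?W\<^esub> ?g = ?g \<circ> ?g" using W.inv_equality[of "?g \<circ> ?g" ?g] g3 gW W.m_closed[OF gW gW] by simp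
  have tt: "?t \<circ> ?t = id" by (auto simp: fun_eq_iff transpose_def p_eq)
  then have tinv: "inv\<^bsub>?W\<^esub> ?t = ?t" using W.inv_equality[of ?t ?t] tW by simp
  have tgt: "?t \<circ> ?g \<circ> ?t = ?g \<circ> ?g" by (auto simp: fun_eq_iff transpose_def p_eq)
  have "?g (p 0) \<noteq> p 0" by (simp add: transpose_def p_eq)
  then have g1: "?g \<noteq> id" by (metis id_apply)
  have D: "?g \<in> D \<and> ?t \<in> D" if D: "D \<lhd> ?W" "D \<noteq> {id}" for D
  proof -
    interpret D: normal D ?W by fact
    have c: "cycle3 (p i) (p j) (p k) \<in> D" if "i < 5" "j < 5" "k < 5" "distinct [i, j, k]" for i j k
      by (rule normal_wreath5_cycle3[OF D]) (use that p in \<open>auto simp: p_eq\<close>, simp_all add: p_def)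
    have "cycle3 (p 0) (p 1) (p 3) \<circ> cycle3 (p 1) (p 3) (p 4) \<in> D"
      using subgroup.m_closed[OF D.subgroup_axioms, OF c[of 0 1 3] c[of 1 3 4]] by simp
    also have "cycle3 (p 0) (p 1) (p 3) \<circ> cycle3 (p 1) (p 3) (p 4) = ?t"
      by (auto simp: fun_eq_iff transpose_def p_eq)
    finally have "?t \<in> D" .
    moreover have "?g \<in> D" by (rule c) simp_all
    ultimately show ?thesis by (rule conjI[rotated])
  qed
  show ?thesis
    by (rule that[of ?W _ ?g ?t, OF W.is_group finite_wreath5[OF fin] wreath5_hom gW tW])
      (use g1 g3 ginv tinv tgt D in auto)
qed

section \<open>An extension without lifts of order 3\<close>

text \<open>Let \<open>g\<close> have order 3. The group \<open>lift9 G g \<theta>\<close> consists of the lifts of the left translations of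
  \<open>G\<close> to permutations of a set covering \<open>G\<close>, on which right multiplication by \<open>g\<close> lifts to a
  permutation of order 9. The function \<open>\<theta>\<close> is a coordinate modulo 3 on the cosets of \<open>\<langle>g\<rangle>\<close>; the values
  of \<open>F\<close> live in the ring \<open>\<int>/9\<int>\<close> and \<open>3 * F v = 3 * c\<close> says that \<open>F v\<close> and \<open>c\<close> agree modulo 3.\<close>

definition lift9 :: "('a, 'b) monoid_scheme \<Rightarrow> 'a \<Rightarrow> ('a \<Rightarrow> 9) \<Rightarrow> ('a \<times> ('a \<Rightarrow> 9)) monoid" where
  "lift9 G g \<theta> = \<lparr>
    carrier = {(w, F). w \<in> carrier G \<and> (\<forall>v. v \<notin> carrier G \<longrightarrow> F v = 0) \<and>
      (\<forall>v\<in>carrier G. F (v \<otimes>\<^bsub>G\<^esub> g) = F v \<and> 3 * F v = 3 * (\<theta> (w \<otimes>\<^bsub>G\<^esub> v) - \<theta> v))},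
    monoid.mult = (\<lambda>(w, F) (w', F'). (w \<otimes>\<^bsub>G\<^esub> w', \<lambda>v. if v \<in> carrier G then F' v + F (w' \<otimes>\<^bsub>G\<^esub> v) else 0)),
    one = (\<one>\<^bsub>G\<^esub>, \<lambda>_. 0)\<rparr>"

lemma lift9_simps [simp]:
  "(w, F) \<otimes>\<^bsub>lift9 G g \<theta>\<^esub> (w', F') =
    (w \<otimes>\<^bsub>G\<^esub> w', \<lambda>v. if v \<in> carrier G then F' v + F (w' \<otimes>\<^bsub>G\<^esub> v) else 0)"
  "\<one>\<^bsub>lift9 G g \<theta>\<^esub> = (\<one>\<^bsub>G\<^esub>, \<lambda>_. 0)"
  by (simp_all add: lift9_def)

lemma lift9_carrier:
  "(w, F) \<in> carrier (lift9 G g \<theta>) \<longleftrightarrow> w \<in> carrier G \<and> (\<forall>v. v \<notin> carrier G \<longrightarrow> F v = 0) \<and>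
      (\<forall>v\<in>carrier G. F (v \<otimes>\<^bsub>G\<^esub> g) = F v \<and> 3 * F v = 3 * (\<theta> (w \<otimes>\<^bsub>G\<^esub> v) - \<theta> v))"
  by (simp add: lift9_def)

lemma (in group) group_lift9:
  assumes g: "g \<in> carrier G"
  shows "group (lift9 G g \<theta>)"
proof (rule groupI)
  fix x y assume "x \<in> carrier (lift9 G g \<theta>)" "y \<in> carrier (lift9 G g \<theta>)"
  then obtain w F w' F' where xy: "x = (w, F)" "y = (w', F')" and w: "w \<in> carrier G" "w' \<in> carrier G"
    and F: "\<And>v. v \<in> carrier G \<Longrightarrow> F (v \<otimes> g) = F v"
      "\<And>v. v \<in> carrier G \<Longrightarrow> 3 * F v = 3 * (\<theta> (w \<otimes> v) - \<theta> v)"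
    and F': "\<And>v. v \<in> carrier G \<Longrightarrow> F' (v \<otimes> g) = F' v"
      "\<And>v. v \<in> carrier G \<Longrightarrow> 3 * F' v = 3 * (\<theta> (w' \<otimes> v) - \<theta> v)"
    by (cases x; cases y) (auto simp: lift9_carrier)
  let ?F = "\<lambda>v. if v \<in> carrier G then F' v + F (w' \<otimes> v) else 0"
  have "?F (v \<otimes> g) = ?F v \<and> 3 * ?F v = 3 * (\<theta> (w \<otimes> w' \<otimes> v) - \<theta> v)" if v: "v \<in> carrier G" for v
  proof
    show "?F (v \<otimes> g) = ?F v" using v w g F(1)[of "w' \<otimes> v"] F'(1)[OF v] by (simp add: m_assoc)
    \<comment> \<open>The congruences of the two factors telescope through
      \<open>\<theta> (w' \<otimes> v)\<close>.\<close>
    have "3 * ?F v = 3 * F' v + 3 * F (w' \<otimes> v)" using v by (simp add: distrib_left)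
    also have "\<dots> = 3 * (\<theta> (w' \<otimes> v) - \<theta> v) + 3 * (\<theta> (w \<otimes> (w' \<otimes> v)) - \<theta> (w' \<otimes> v))"
      using F(2)[of "w' \<otimes> v"] F'(2)[OF v] v w by simp
    also have "\<dots> = 3 * (\<theta> (w \<otimes> w' \<otimes> v) - \<theta> v)"
      using v w by (simp add: m_assoc right_diff_distrib)
    finally show "3 * ?F v = 3 * (\<theta> (w \<otimes> w' \<otimes> v) - \<theta> v)" .
  qed
  then show "x \<otimes>\<^bsub>lift9 G g \<theta>\<^esub> y \<in> carrier (lift9 G g \<theta>)"
    unfolding xy lift9_simps lift9_carrier using w by simp
next
  show "\<one>\<^bsub>lift9 G g \<theta>\<^esub> \<in> carrier (lift9 G g \<theta>)" by (simp add: lift9_carrier)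
next
  fix x y z
  assume "x \<in> carrier (lift9 G g \<theta>)" "y \<in> carrier (lift9 G g \<theta>)" "z \<in> carrier (lift9 G g \<theta>)"
  then show "x \<otimes>\<^bsub>lift9 G g \<theta>\<^esub> y \<otimes>\<^bsub>lift9 G g \<theta>\<^esub> z = x \<otimes>\<^bsub>lift9 G g \<theta>\<^esub> (y \<otimes>\<^bsub>lift9 G g \<theta>\<^esub> z)"
    by (cases x; cases y; cases z) (auto simp: lift9_carrier m_assoc fun_eq_iff)
next
  fix x assume "x \<in> carrier (lift9 G g \<theta>)"
  then show "\<one>\<^bsub>lift9 G g \<theta>\<^esub> \<otimes>\<^bsub>lift9 G g \<theta>\<^esub> x = x"
    by (cases x) (auto simp: lift9_carrier fun_eq_iff)
next
  fix x assume "x \<in> carrier (lift9 G g \<theta>)"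
  then obtain w F where x: "x = (w, F)" and w: "w \<in> carrier G" and F0: "\<And>v. v \<notin> carrier G \<Longrightarrow> F v = 0"
    and Fg: "\<And>v. v \<in> carrier G \<Longrightarrow> F (v \<otimes> g) = F v"
    and F3: "\<And>v. v \<in> carrier G \<Longrightarrow> 3 * F v = 3 * (\<theta> (w \<otimes> v) - \<theta> v)"
    by (cases x) (auto simp: lift9_carrier)
  \<comment> \<open>Solves \<open>F v + ?F (w \<otimes> v) = 0\<close>, the second coordinate of the
    product with \<open>x\<close>.\<close>
  let ?F = "\<lambda>v. if v \<in> carrier G then - F (inv w \<otimes> v) else 0"
  have "(inv w, ?F) \<in> carrier (lift9 G g \<theta>)"
    unfolding lift9_carrier
  proof (intro conjI ballI allI impI)
    fix v assume v: "v \<in> carrier G"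
    show "?F (v \<otimes> g) = ?F v" using v w g Fg[of "inv w \<otimes> v"] by (simp add: m_assoc)
    have "3 * F (inv w \<otimes> v) = 3 * (\<theta> v - \<theta> (inv w \<otimes> v))"
      using F3[of "inv w \<otimes> v"] v w by (simp add: inv_cancel_left)
    then show "3 * ?F v = 3 * (\<theta> (inv w \<otimes> v) - \<theta> v)" using v by (simp add: algebra_simps)
  qed (use w in simp_all)
  moreover have "(inv w, ?F) \<otimes>\<^bsub>lift9 G g \<theta>\<^esub> x = \<one>\<^bsub>lift9 G g \<theta>\<^esub>"
    using w F0 by (auto simp: x inv_cancel_left fun_eq_iff)
  ultimately show "\<exists>y\<in>carrier (lift9 G g \<theta>). y \<otimes>\<^bsub>lift9 G g \<theta>\<^esub> x = \<one>\<^bsub>lift9 G g \<theta>\<^esub>" by blast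
qed

text \<open>The functions vanish outside the finite carrier and take values in a finite ring, so
  there are finitely many even over an infinite type.\<close>

lemma finite_lift9:
  assumes "finite (carrier G)"
  shows "finite (carrier (lift9 G g \<theta>))"
proof (rule finite_subset)
  show "carrier (lift9 G g \<theta>) \<subseteq> carrier G \<times> {F. \<forall>v. (v \<in> carrier G \<longrightarrow> F v \<in> UNIV) \<and> (v \<notin> carrier G \<longrightarrow> F v = 0)}"
    by (auto simp: lift9_carrier)
  show "finite (carrier G \<times> {F. \<forall>v. (v \<in> carrier G \<longrightarrow> F v \<in> (UNIV :: 9 set)) \<and> (v \<notin> carrier G \<longrightarrow> F v = 0)})"
    using assms by (intro finite_cartesian_product finite_set_of_finite_funs) simp_all
qed

text \<open>Choose a representative in each left coset of the subgroup generated by \<open>g\<close>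
  and count powers of \<open>g\<close> from it. The wrap from 2 to 0 is consistent because
  \<open>3 * 2 + 3\<close> is 9, which is 0 in the ring.\<close>

lemma (in group) exists_coset_coordinate:
  assumes g: "g \<in> carrier G" "g \<noteq> \<one>" "g \<otimes> g \<otimes> g = \<one>"
  obtains \<theta> :: "'a \<Rightarrow> 9" where "\<And>v. v \<in> carrier G \<Longrightarrow> 3 * \<theta> (v \<otimes> g) = 3 * \<theta> v + 3"
proof -
  define C where "C v = {v, v \<otimes> g, v \<otimes> g \<otimes> g}" for v
  define r where "r v = (SOME x. x \<in> C v)" for v
  define \<theta> :: "'a \<Rightarrow> 9" where "\<theta> v = (if v = r v then 0 else if v = r v \<otimes> g then 1 else 2)" for v
  have ggg: "v \<otimes> g \<otimes> g \<otimes> g = v" if "v \<in> carrier G" for v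
    using that g by (metis m_assoc m_closed r_one)
  have gg: "g \<otimes> g \<noteq> \<one>" using g by (metis l_one)
  have nine: "(9 :: 9) = 0" by simp
  have "3 * \<theta> (v \<otimes> g) = 3 * \<theta> v + 3" if v: "v \<in> carrier G" for v
  proof -
    \<comment> \<open>\<open>v\<close> and \<open>v \<otimes> g\<close> span the same set
      \<open>C\<close>, so the choice operator picks the same representative.\<close>
    have rvg: "r (v \<otimes> g) = r v" using ggg[OF v] by (simp add: r_def C_def insert_commute)
    have "r v \<in> C v" unfolding r_def by (rule someI[of _ v]) (simp add: C_def)
    then have "v \<in> {r v, r v \<otimes> g, r v \<otimes> g \<otimes> g}" and rc: "r v \<in> carrier G"
      using ggg[OF v] v g(1) by (auto simp: C_def)
    moreover have "r v \<otimes> g \<noteq> r v" using rc g by simp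
    moreover have "r v \<otimes> g \<otimes> g \<noteq> r v" using rc g gg by (simp add: m_assoc)
    moreover have "r v \<otimes> g \<otimes> g \<noteq> r v \<otimes> g" using rc g by simp
    moreover have "r v \<otimes> g \<otimes> g \<otimes> g = r v" by (rule ggg[OF rc])
    ultimately consider "\<theta> v = 0" "\<theta> (v \<otimes> g) = 1" | "\<theta> v = 1" "\<theta> (v \<otimes> g) = 2" | "\<theta> v = 2" "\<theta> (v \<otimes> g) = 0"
      unfolding \<theta>_def rvg by (smt (verit) empty_iff insert_iff)
    then show ?thesis by cases (use nine in simp_all)
  qed
  then show ?thesis by (rule that)
qed

text \<open>The constructions above live on function types, while a class of groups is a predicate
  on one fixed type; finite groups are carried over along a bijection.\<close>

lemma (in group) exists_finite_copy:
  assumes "finite (carrier G)" "infinite (UNIV :: 'c set)"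
  obtains H :: "'c monoid" and \<phi> where "group H" "finite (carrier H)" "\<phi> \<in> iso H G"
proof -
  obtain B :: "'c set" where B: "finite B" "card B = card (carrier G)"
    using infinite_arbitrarily_large[OF assms(2)] by blast
  then obtain f where f: "bij_betw f (carrier G) B"
    using finite_same_card_bij[OF assms(1)] by metis
  let ?i = "inv_into (carrier G) f"
  have i: "?i (f x) = x" if "x \<in> carrier G" for x
    using f that by (simp add: bij_betw_def)
  define H :: "'c monoid" where "H = \<lparr>carrier = B, monoid.mult = (\<lambda>x y. f (?i x \<otimes> ?i y)), one = f \<one>\<rparr>"
  have "f \<in> iso G H"
    using f by (auto simp: iso_def hom_def H_def i bij_betw_def)
  moreover have "H\<lparr>one := f \<one>\<rparr> = H" by (simp add: H_def)
  ultimately have "group H" using iso_imp_img_group by metis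
  moreover have "?i \<in> iso H G" by (rule iso_set_sym) fact
  moreover have "finite (carrier H)" using B by (simp add: H_def)
  ultimately show ?thesis by (intro that)
qed

text \<open>Kernel elements are functions with values in the multiples of 3, so they commute and
  have cube 1. The cube of a lift of \<open>g\<close> has the value 3 at the identity, which is not
  0 modulo 9.\<close>

lemma (in group) exists_order_9_cover:
  assumes fin: "finite (carrier G)" and inf: "infinite (UNIV :: 'c set)"
    and g: "g \<in> carrier G" "g \<noteq> \<one>" "g \<otimes> g \<otimes> g = \<one>"
  obtains E :: "'c monoid" and \<pi> where "group E" "finite (carrier E)" "\<pi> \<in> hom E G"
    "\<pi> ` carrier E = carrier G"
    "\<And>a b. a \<in> kernel E G \<pi> \<Longrightarrow> b \<in> kernel E G \<pi> \<Longrightarrow> a \<otimes>\<^bsub>E\<^esub> b = b \<otimes>\<^bsub>E\<^esub> a"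
    "\<And>a. a \<in> kernel E G \<pi> \<Longrightarrow> a \<otimes>\<^bsub>E\<^esub> a \<otimes>\<^bsub>E\<^esub> a = \<one>\<^bsub>E\<^esub>"
    "\<And>x. x \<in> carrier E \<Longrightarrow> \<pi> x = g \<Longrightarrow> x \<otimes>\<^bsub>E\<^esub> x \<otimes>\<^bsub>E\<^esub> x \<noteq> \<one>\<^bsub>E\<^esub>"
proof -
  obtain \<theta> :: "'a \<Rightarrow> 9" where \<theta>: "\<And>v. v \<in> carrier G \<Longrightarrow> 3 * \<theta> (v \<otimes> g) = 3 * \<theta> v + 3"
    using exists_coset_coordinate[OF g] by blast
  let ?L = "lift9 G g \<theta>"
  interpret L: group ?L by (rule group_lift9[OF g(1)])
  have hom: "fst \<in> hom ?L G" by (auto simp: hom_def lift9_carrier)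
  have surj: "fst ` carrier ?L = carrier G"
  proof (intro subset_antisym subsetI)
    fix w assume w: "w \<in> carrier G"
    \<comment> \<open>The lift of a residue depends on it modulo 3 only; this makes
      \<open>?F\<close> invariant under right multiplication by \<open>g\<close>.\<close>
    define s :: "9 \<Rightarrow> 9" where "s x = (SOME y. 3 * y = 3 * x)" for x
    have s: "3 * s x = 3 * x" for x unfolding s_def by (rule someI[of _ x]) simp
    have s_cong: "s x = s y" if "3 * x = 3 * y" for x y using that by (simp add: s_def)
    let ?F = "\<lambda>v. if v \<in> carrier G then s (\<theta> (w \<otimes> v) - \<theta> v) else 0"
    have "(w, ?F) \<in> carrier ?L" unfolding lift9_carrier
    proof (intro conjI ballI allI impI)
      fix v assume v: "v \<in> carrier G"
      have "3 * (\<theta> (w \<otimes> (v \<otimes> g)) - \<theta> (v \<otimes> g)) = 3 * (\<theta> (w \<otimes> v) - \<theta> v)"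
        using \<theta>[OF v] \<theta>[of "w \<otimes> v"] v w g(1) by (simp add: right_diff_distrib m_assoc)
      then show "?F (v \<otimes> g) = ?F v" using v w g(1) s_cong by simp
      show "3 * ?F v = 3 * (\<theta> (w \<otimes> v) - \<theta> v)" using v s by simp
    qed (use w in simp_all)
    from imageI[OF this, of fst] show "w \<in> fst ` carrier ?L" by (simp only: fst_conv)
  qed (auto simp: lift9_carrier)
  have ker: "\<exists>F. a = (\<one>, F) \<and> (\<forall>v. v \<notin> carrier G \<longrightarrow> F v = 0) \<and> (\<forall>v. 3 * F v = 0)" if "a \<in> kernel ?L G fst" for a
  proof (cases a)
    case (Pair w F)
    have "3 * F v = 0" for v
      using that Pair by (cases "v \<in> carrier G") (auto simp: kernel_def lift9_carrier)
    then show ?thesis using that Pair by (auto simp: kernel_def lift9_carrier)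
  qed
  have ker_comm: "a \<otimes>\<^bsub>?L\<^esub> b = b \<otimes>\<^bsub>?L\<^esub> a" if "a \<in> kernel ?L G fst" "b \<in> kernel ?L G fst" for a b
    using ker[OF that(1)] ker[OF that(2)] by (auto simp: fun_eq_iff add.commute)
  have ker3: "a \<otimes>\<^bsub>?L\<^esub> a \<otimes>\<^bsub>?L\<^esub> a = \<one>\<^bsub>?L\<^esub>" if "a \<in> kernel ?L G fst" for a
    using ker[OF that] by (auto simp: fun_eq_iff)
  have lift: "x \<otimes>\<^bsub>?L\<^esub> x \<otimes>\<^bsub>?L\<^esub> x \<noteq> \<one>\<^bsub>?L\<^esub>" if x: "x \<in> carrier ?L" "fst x = g" for x
  proof
    assume eq: "x \<otimes>\<^bsub>?L\<^esub> x \<otimes>\<^bsub>?L\<^esub> x = \<one>\<^bsub>?L\<^esub>"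
    obtain F where F: "x = (g, F)" using x(2) by (cases x) auto
    have Fg: "F (v \<otimes> g) = F v" "3 * F v = 3 * (\<theta> (g \<otimes> v) - \<theta> v)" if "v \<in> carrier G" for v
      using x(1) that unfolding F lift9_carrier by blast+
    \<comment> \<open>The second coordinate of the cube, evaluated at the identity; by invariance
      its three summands are equal.\<close>
    have "F \<one> + (F g + F (g \<otimes> g)) = 0"
      using arg_cong[OF eq, of "\<lambda>y. snd y \<one>"] g(1) by (simp add: F)
    moreover have "F g = F \<one>" using Fg(1)[of \<one>] g(1) by simp
    moreover have "F (g \<otimes> g) = F g" using Fg(1)[OF g(1)] .
    ultimately have "3 * F \<one> = 0" by simp
    moreover have "3 * F \<one> = 3 * \<theta> g - 3 * \<theta> \<one>" using Fg(2)[of \<one>] g(1) by (simp add: right_diff_distrib)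
    ultimately show False using \<theta>[of \<one>] g(1) by simp
  qed
  obtain E :: "'c monoid" and \<phi> where E: "group E" "finite (carrier E)" "\<phi> \<in> iso E ?L"
    using L.exists_finite_copy[OF finite_lift9[OF fin] inf] by blast
  interpret E: group E by fact
  interpret \<phi>: group_hom E ?L \<phi> using E(3) by (auto simp: group_hom_def group_hom_axioms_def iso_def E(1))
  have \<phi>: "inj_on \<phi> (carrier E)" "\<phi> ` carrier E = carrier ?L" using E(3) by (auto simp: iso_def bij_betw_def)
  have ker_\<phi>: "\<phi> a \<in> kernel ?L G fst" "a \<in> carrier E" if "a \<in> kernel E G (\<lambda>x. fst (\<phi> x))" for a
    using that by (auto simp: kernel_def)
  show ?thesis
  proof (rule that[of E "\<lambda>x. fst (\<phi> x)"])
    show "(\<lambda>x. fst (\<phi> x)) \<in> hom E G"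
      using Group.hom_compose[OF \<phi>.homh hom] by (simp add: comp_def)
    show "(\<lambda>x. fst (\<phi> x)) ` carrier E = carrier G"
      using surj \<phi>(2) by (metis image_image)
    show "a \<otimes>\<^bsub>E\<^esub> b = b \<otimes>\<^bsub>E\<^esub> a"
      if "a \<in> kernel E G (\<lambda>x. fst (\<phi> x))" "b \<in> kernel E G (\<lambda>x. fst (\<phi> x))" for a b
    proof (rule inj_onD[OF \<phi>(1)])
      show "\<phi> (a \<otimes>\<^bsub>E\<^esub> b) = \<phi> (b \<otimes>\<^bsub>E\<^esub> a)"
        using ker_comm[OF ker_\<phi>(1) ker_\<phi>(1), OF that] ker_\<phi>(2)[OF that(1)] ker_\<phi>(2)[OF that(2)]
        by (simp del: lift9_simps)
    qed (use ker_\<phi>(2)[OF that(1)] ker_\<phi>(2)[OF that(2)] in simp_all)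
    show "a \<otimes>\<^bsub>E\<^esub> a \<otimes>\<^bsub>E\<^esub> a = \<one>\<^bsub>E\<^esub>" if "a \<in> kernel E G (\<lambda>x. fst (\<phi> x))" for a
    proof (rule inj_onD[OF \<phi>(1)])
      show "\<phi> (a \<otimes>\<^bsub>E\<^esub> a \<otimes>\<^bsub>E\<^esub> a) = \<phi> \<one>\<^bsub>E\<^esub>"
        using ker3[OF ker_\<phi>(1)[OF that]] ker_\<phi>(2)[OF that] by (simp del: lift9_simps)
    qed (use ker_\<phi>(2)[OF that] in simp_all)
    show "x \<otimes>\<^bsub>E\<^esub> x \<otimes>\<^bsub>E\<^esub> x \<noteq> \<one>\<^bsub>E\<^esub>" if x: "x \<in> carrier E" "fst (\<phi> x) = g" for x
    proof
      assume "x \<otimes>\<^bsub>E\<^esub> x \<otimes>\<^bsub>E\<^esub> x = \<one>\<^bsub>E\<^esub>"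
      then have "\<phi> (x \<otimes>\<^bsub>E\<^esub> x \<otimes>\<^bsub>E\<^esub> x) = \<one>\<^bsub>?L\<^esub>" by (simp del: lift9_simps)
      then show False using lift[OF \<phi>.hom_closed[OF x(1)] x(2)] x(1) by (simp del: lift9_simps)
    qed
  qed (use E in simp_all)
qed

section \<open>Frattini covers with small generalized Fitting subgroup\<close>

text \<open>Only the top of the tower has to live on \<open>'c\<close>: the wreath product keeps its
  own type, the extension \<open>E\<close> is copied to \<open>'c\<close>, and \<open>H\<close> is a
  subgroup of \<open>E\<close>.\<close>

lemma (in group) finite_quotient_of_F_star_subnormal:
  assumes fin: "finite (carrier G)" and inf: "infinite (UNIV :: 'c set)"
  obtains H :: "'c monoid" and h where "group H" "finite (carrier H)" "h \<in> hom H G" "h ` carrier H = carrier G"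
    "\<And>M. maximal_subgroup H M \<Longrightarrow> R_subnormal H (F_star H) M"
proof -
  obtain W :: "('a \<times> nat \<Rightarrow> 'a \<times> nat) monoid" and \<rho> g t where W: "group W" "finite (carrier W)"
    and \<rho>: "\<rho> \<in> hom W G" "\<rho> ` carrier W = carrier G"
    and gt: "g \<in> carrier W" "t \<in> carrier W" "g \<noteq> \<one>\<^bsub>W\<^esub>" "g \<otimes>\<^bsub>W\<^esub> g \<otimes>\<^bsub>W\<^esub> g = \<one>\<^bsub>W\<^esub>"
      "t \<otimes>\<^bsub>W\<^esub> g \<otimes>\<^bsub>W\<^esub> inv\<^bsub>W\<^esub> t = inv\<^bsub>W\<^esub> g"
    and D: "\<And>D. D \<lhd> W \<Longrightarrow> D \<noteq> {\<one>\<^bsub>W\<^esub>} \<Longrightarrow> g \<in> D \<and> t \<in> D"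
    by (rule exists_cover_with_real_order_3[OF fin]) (rule that; (assumption | blast))
  interpret W: group W by fact
  obtain E :: "'c monoid" and \<pi> where E: "group E" "finite (carrier E)" and \<pi>: "\<pi> \<in> hom E W"
    "\<pi> ` carrier E = carrier W"
    and ker: "\<And>a b. a \<in> kernel E W \<pi> \<Longrightarrow> b \<in> kernel E W \<pi> \<Longrightarrow> a \<otimes>\<^bsub>E\<^esub> b = b \<otimes>\<^bsub>E\<^esub> a"
      "\<And>a. a \<in> kernel E W \<pi> \<Longrightarrow> a \<otimes>\<^bsub>E\<^esub> a \<otimes>\<^bsub>E\<^esub> a = \<one>\<^bsub>E\<^esub>"
    and lift: "\<And>x. x \<in> carrier E \<Longrightarrow> \<pi> x = g \<Longrightarrow> x \<otimes>\<^bsub>E\<^esub> x \<otimes>\<^bsub>E\<^esub> x \<noteq> \<one>\<^bsub>E\<^esub>"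
    by (rule W.exists_order_9_cover[OF W(2) inf gt(1,3,4)]) (rule that; (assumption | blast))
  interpret E: group E by fact
  let ?P = "\<lambda>U. subgroup U E \<and> \<pi> ` U = carrier W"
  have "?P (carrier E)" using \<pi>(2) E.subgroup_self by simp
  \<comment> \<open>A subgroup of least order among those mapping onto \<open>W\<close>; this yields
    the minimality that forces the kernel into all maximal subgroups.\<close>
  then obtain U where U: "?P U" and least: "\<And>V. ?P V \<Longrightarrow> card U \<le> card V"
    using ex_has_least_nat[of ?P "carrier E" card] by blast
  interpret U: subgroup U E using U by simp
  define H where "H = E\<lparr>carrier := U\<rparr>"
  interpret H: group H unfolding H_def by (rule U.subgroup_is_group[OF E(1)])
  have finU: "finite U" by (rule finite_subset[OF U.subset E(2)])
  have \<pi>H: "\<pi> \<in> hom H W" "\<pi> ` carrier H = carrier W" using \<pi>(1) U by (auto simp: hom_def H_def)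
  interpret \<pi>: group_hom H W \<pi> using \<pi>H(1) by (simp add: group_hom_def group_hom_axioms_def W(1) H.is_group)
  have kerH: "kernel H W \<pi> \<subseteq> kernel E W \<pi>" by (auto simp: kernel_def H_def)
  have "R_subnormal H (F_star H) M" if "maximal_subgroup H M" for M
  proof (rule \<pi>.frattini_cover_F_star[OF _ \<pi>H(2) _ gt D _ _ _ that])
    fix V assume V: "subgroup V H" "\<pi> ` V = carrier W"
    have "subgroup V E" using E.incl_subgroup[OF U.subgroup_axioms] V(1) by (simp add: H_def)
    then have "card U \<le> card V" using least V(2) by blast
    moreover have "V \<subseteq> U" using subgroup.subset[OF V(1)] by (simp add: H_def)
    ultimately show "V = carrier H" using card_seteq[OF finU] by (simp add: H_def)
  next
    show "a \<otimes>\<^bsub>H\<^esub> b = b \<otimes>\<^bsub>H\<^esub> a" if "a \<in> kernel H W \<pi>" "b \<in> kernel H W \<pi>" for a b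
      using ker(1)[OF subsetD[OF kerH that(1)] subsetD[OF kerH that(2)]] by (simp add: H_def)
    show "a \<otimes>\<^bsub>H\<^esub> a \<otimes>\<^bsub>H\<^esub> a = \<one>\<^bsub>H\<^esub>" if "a \<in> kernel H W \<pi>" for a
      using ker(2)[OF subsetD[OF kerH that]] by (simp add: H_def)
    show "x \<otimes>\<^bsub>H\<^esub> x \<otimes>\<^bsub>H\<^esub> x \<noteq> \<one>\<^bsub>H\<^esub>" if "x \<in> carrier H" "\<pi> x = g" for x
      using lift[of x] that by (simp add: H_def)
  qed (use finU in \<open>simp_all add: H_def\<close>)
  moreover have "\<rho> \<circ> \<pi> \<in> hom H G" by (rule Group.hom_compose[OF \<pi>H(1) \<rho>(1)])
  moreover have "(\<rho> \<circ> \<pi>) ` carrier H = carrier G" unfolding image_comp[symmetric] \<pi>H(2) by (rule \<rho>(2))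
  moreover have "finite (carrier H)" using finU by (simp add: H_def)
  ultimately show ?thesis using that H.is_group by blast
qed

text \<open>A class of finite groups is modelled by a predicate on structures over an infinite type,
  where every finite group has a copy. Closure under surjective homomorphisms includes closure under
  isomorphism.\<close>

theorem theorem10:
  shows "(\<forall>G :: ('a, 'b) monoid_scheme. group G \<longrightarrow> finite (carrier G) \<longrightarrow>
           (nilpotent_group G \<longleftrightarrow>
              (\<forall>M. maximal_subgroup G M \<longrightarrow> R_subnormal G (F_tilde G) M)))
       \<and> (\<forall>\<FF> :: 'c monoid \<Rightarrow> bool.
           infinite (UNIV :: 'c set) \<longrightarrow>
           (\<forall>G. \<FF> G \<longrightarrow> group G \<and> finite (carrier G)) \<longrightarrow>
           (\<forall>G H h. \<FF> G \<longrightarrow> group H \<longrightarrow> h \<in> hom G H \<longrightarrow> h ` carrier G = carrier H \<longrightarrow> \<FF> H) \<longrightarrow>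
           (\<forall>G. group G \<longrightarrow> finite (carrier G) \<longrightarrow>
                (\<forall>M. maximal_subgroup G M \<longrightarrow> R_subnormal G (F_star G) M) \<longrightarrow> \<FF> G) \<longrightarrow>
           (\<forall>G. \<FF> G \<longleftrightarrow> group G \<and> finite (carrier G)))"
proof (intro conjI allI impI)
  fix G :: "('a, 'b) monoid_scheme"
  assume "group G" "finite (carrier G)"
  then show "nilpotent_group G \<longleftrightarrow> (\<forall>M. maximal_subgroup G M \<longrightarrow> R_subnormal G (F_tilde G) M)"
    by (rule group.nilpotent_iff_maximal_F_tilde_subnormal)
next
  fix \<FF> :: "'c monoid \<Rightarrow> bool" and G :: "'c monoid"
  assume inf: "infinite (UNIV :: 'c set)"
    and sound: "\<forall>G. \<FF> G \<longrightarrow> group G \<and> finite (carrier G)"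
    and quot: "\<forall>G H h. \<FF> G \<longrightarrow> group H \<longrightarrow> h \<in> hom G H \<longrightarrow> h ` carrier G = carrier H \<longrightarrow> \<FF> H"
    and F_star: "\<forall>G. group G \<longrightarrow> finite (carrier G) \<longrightarrow>
                (\<forall>M. maximal_subgroup G M \<longrightarrow> R_subnormal G (F_star G) M) \<longrightarrow> \<FF> G"
  show "\<FF> G \<longleftrightarrow> group G \<and> finite (carrier G)"
  proof
    assume G: "group G \<and> finite (carrier G)"
    obtain H :: "'c monoid" and h where H: "group H" "finite (carrier H)" "h \<in> hom H G" "h ` carrier H = carrier G"
      "\<And>M. maximal_subgroup H M \<Longrightarrow> R_subnormal H (F_star H) M"
      using group.finite_quotient_of_F_star_subnormal[OF conjunct1[OF G] conjunct2[OF G] inf] by blast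
    have "\<FF> H" using F_star H(1,2,5) by blast
    then show "\<FF> G" using quot G H(3,4) by blast
  qed (use sound in blast)
qed

end
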